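(* Let $L=\mathbb{F}_2[X,X^{-1}]\rtimes\mathbb{Z}$ be the lamplighter group. Let $a=(0,1)$, $c=(1,0)$, and $b=ac$. Consider the generating sets $S=\{a,c\}$ and $S'=\{a,b\}$ of $L$. (1) The combinatorial Laplace operator on the Cayley graph of $(L,S)$ has no square-summable eigenfunction. (2) The space $l^2(L)$ admits an orthonormal Hilbert basis made of finitely supported eigenfunctions of the combinatorial Laplacian of the Cayley graph of $(L,S')$.
   Context: Lamplighter group: $\mathbb{F}_2[X,X^{-1}]$ is the ring of Laurent polynomials over the field $\mathbb{F}_2$ with two elements; its group of units $\{X^n:n\in\mathbb{Z}\}\cong\mathbb{Z}$ acts on the additive group $\mathbb{F}_2[X,X^{-1}]$ by multiplication, and $L$ is the corresponding semi-direct product, so $(P,n)(Q,m)=(P+X^nQ,\,n+m)$. Cayley graph: for a group $G$ and a (not necessarily symmetric) generating set $S\subset G$, the Cayley graph $\mathcal{C}(G,S)$ has vertex set $G$ and oriented edge set $(G\times S)\sqcup\overline{(G\times S)}$, where $(g,s)$ has origin $g$ and terminus $gs$, and $\overline{(g,s)}$ has origin $gs$ and terminus $g$ (loops and multiple edges are allowed). Combinatorial Laplacian of $\mathcal{C}(G,S)$, $S$ finite: the bounded self-adjoint operator on $l^2(G)$ (counting measure, complex valued functions) $$\Delta\varphi(g)=\varphi(g)-\frac{1}{2|S|}\sum_{s\in S}\left(\varphi(gs)+\varphi(gs^{-1})\right).$$ An eigenfunction is a nonzero $\varphi\in l^2(G)$ with $\Delta\varphi=\lambda\varphi$ for some $\lambda\in\mathbb{R}$.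 *)

theory Defs
  imports
    "HOL-Analysis.Infinite_Sum"
    "HOL-Algebra.Generated_Groups"
    "HOL-Library.Poly_Mapping"
    "HOL-Library.Z2"
begin

section \<open>The lamplighter group\<close>

text \<open>
  The ring of Laurent polynomials over the two-element field is the group ring of the integers:
  finitely supported functions from exponents to coefficients, with the convolution product.
\<close>

type_synonym laurent_F2 = "int \<Rightarrow>\<^sub>0 bit"

definition X_pow :: "int \<Rightarrow> laurent_F2" where
  "X_pow n = Poly_Mapping.single n 1"

definition lamplighter :: "(laurent_F2 \<times> int) monoid" where
  "lamplighter = \<lparr> carrier = UNIV,
     mult = (\<lambda>(P, n) (Q, m). (P + X_pow n * Q, n + m)),
     one = (0, 0) \<rparr>"

lemma X_pow_0: "X_pow 0 = 1"
  by (simp add: X_pow_def)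

lemma X_pow_add: "X_pow (m + n) = X_pow m * X_pow n"
  by (simp add: X_pow_def mult_single)

lemma carrier_lamplighter [simp]: "carrier lamplighter = UNIV"
  by (simp add: lamplighter_def)

lemma one_lamplighter [simp]: "\<one>\<^bsub>lamplighter\<^esub> = (0, 0)"
  by (simp add: lamplighter_def)

lemma mult_lamplighter [simp]:
  "(P, n) \<otimes>\<^bsub>lamplighter\<^esub> (Q, m) = (P + X_pow n * Q, n + m)"
  by (simp add: lamplighter_def)

lemma group_lamplighter: "group lamplighter"
proof (rule groupI)
  fix x y z :: "laurent_F2 \<times> int"
  show "x \<otimes>\<^bsub>lamplighter\<^esub> y \<otimes>\<^bsub>lamplighter\<^esub> z = x \<otimes>\<^bsub>lamplighter\<^esub> (y \<otimes>\<^bsub>lamplighter\<^esub> z)"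
    by (cases x; cases y; cases z) (simp add: X_pow_add algebra_simps)
  show "\<one>\<^bsub>lamplighter\<^esub> \<otimes>\<^bsub>lamplighter\<^esub> x = x"
    by (cases x) (simp add: X_pow_0)
  show "\<exists>y\<in>carrier lamplighter. y \<otimes>\<^bsub>lamplighter\<^esub> x = \<one>\<^bsub>lamplighter\<^esub>"
  proof (cases x)
    case (Pair P n)
    then have "(- (X_pow (- n) * P), - n) \<otimes>\<^bsub>lamplighter\<^esub> x = \<one>\<^bsub>lamplighter\<^esub>"
      by simp
    then show ?thesis
      by (metis UNIV_I carrier_lamplighter)
  qed
qed auto

lemma inv_lamplighter:
  "inv\<^bsub>lamplighter\<^esub> (P, n) = (- (X_pow (- n) * P), - n)"
  by (rule group.inv_equality[OF group_lamplighter]) auto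

lemma generate_lamplighter:
  "generate lamplighter {(0, 1), (1, 0)} = carrier lamplighter"
proof -
  interpret group lamplighter by (rule group_lamplighter)
  define H where "H = generate lamplighter {(0, 1), (1, 0)}"
  have prod: "x \<otimes>\<^bsub>lamplighter\<^esub> y \<in> H" if "x \<in> H" "y \<in> H" for x y
    using that unfolding H_def by (rule generate.eng)
  have a: "(0, 1) \<in> H" and c: "(1, 0) \<in> H"
    unfolding H_def by (auto intro: generate.incl)
  have a': "(0, -1) \<in> H"
    using generate.inv[of "(0, 1)" "{(0, 1), (1, 0)}" lamplighter]
    by (simp add: H_def inv_lamplighter)
  have z: "(0, 0) \<in> H"
    using generate.one[of lamplighter "{(0, 1), (1, 0)}"] by (simp add: H_def)
  have shift: "(0, n) \<in> H" for n
  proof (induction n rule: int_induct[where k = 0])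
    case base
    show ?case by (rule z)
  next
    case (step1 i)
    show ?case using prod[OF step1(2) a] by simp
  next
    case (step2 i)
    show ?case using prod[OF step2(2) a'] by simp
  qed
  have lamp: "(X_pow n, 0) \<in> H" for n
    using prod[OF prod[OF shift[of n] c] shift[of "- n"]] by simp
  have lamps: "(P, 0) \<in> H" for P
  proof (induction P rule: Poly_Mapping.update_induct)
    case const
    show ?case by (rule z)
  next
    case (update f k v)
    have v: "v = 1" using update(2) by simp
    have "Poly_Mapping.update k v f = X_pow k + f"
      using update(1) v
      by (intro poly_mapping_eqI)
        (auto simp: X_pow_def lookup_add lookup_update lookup_single in_keys_iff)
    with prod[OF lamp[of k] update(3)] show ?case by (simp add: X_pow_0)
  qed
  have "(P, n) \<in> H" for P n
    using prod[OF lamps[of P] shift[of n]] by simp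
  then show ?thesis by (auto simp: H_def)
qed

lemma generate_lamplighter':
  "generate lamplighter {(0, 1), (0, 1) \<otimes>\<^bsub>lamplighter\<^esub> (1, 0)} = carrier lamplighter"
    (is "?K = _")
proof -
  interpret group lamplighter by (rule group_lamplighter)
  have a: "(0, 1) \<in> ?K" and b: "(0, 1) \<otimes>\<^bsub>lamplighter\<^esub> (1, 0) \<in> ?K"
    by (auto intro: generate.incl)
  have a': "(0, -1) \<in> ?K"
    using generate.inv[of "(0, 1)" "{(0, 1), (0, 1) \<otimes>\<^bsub>lamplighter\<^esub> (1, 0)}" lamplighter]
    by (simp add: inv_lamplighter)
  have "(1, 0) \<in> ?K"
    using generate.eng[OF a' b] by (simp add: X_pow_0 flip: X_pow_add mult.assoc)
  then have "generate lamplighter {(0, 1), (1, 0)} \<subseteq> ?K"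
    using a by (intro generate_subgroup_incl generate_is_subgroup) auto
  then show ?thesis
    by (simp add: generate_lamplighter top.extremum_unique)
qed


section \<open>Square-summable functions and Hilbert bases\<close>

text \<open>
  Functions on a set \<open>A\<close> are represented by functions on the whole type; only their values
  on \<open>A\<close> matter in the definitions below.
\<close>

definition ell2 :: "'a set \<Rightarrow> ('a \<Rightarrow> complex) set" where
  "ell2 A = {\<phi>. (\<lambda>x. (cmod (\<phi> x))\<^sup>2) summable_on A}"

definition ell2_inner :: "'a set \<Rightarrow> ('a \<Rightarrow> complex) \<Rightarrow> ('a \<Rightarrow> complex) \<Rightarrow> complex" where
  "ell2_inner A \<phi> \<psi> = (\<Sum>\<^sub>\<infinity>x\<in>A. \<phi> x * cnj (\<psi> x))"

definition ell2_norm :: "'a set \<Rightarrow> ('a \<Rightarrow> complex) \<Rightarrow> real" where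
  "ell2_norm A \<phi> = sqrt (\<Sum>\<^sub>\<infinity>x\<in>A. (cmod (\<phi> x))\<^sup>2)"

text \<open>An orthonormal subset whose linear span is dense.\<close>

definition hilbert_basis :: "'a set \<Rightarrow> ('a \<Rightarrow> complex) set \<Rightarrow> bool" where
  "hilbert_basis A B \<longleftrightarrow>
     B \<subseteq> ell2 A \<and>
     (\<forall>\<phi>\<in>B. \<forall>\<psi>\<in>B. ell2_inner A \<phi> \<psi> = (if \<phi> = \<psi> then 1 else 0)) \<and>
     (\<forall>\<phi>\<in>ell2 A. \<forall>\<epsilon>>0. \<exists>F k. finite F \<and> F \<subseteq> B \<and>
        ell2_norm A (\<lambda>x. \<phi> x - (\<Sum>\<beta>\<in>F. k \<beta> * \<beta> x)) < \<epsilon>)"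


section \<open>The combinatorial Laplacian of a Cayley graph\<close>

text \<open>
  Each \<open>s \<in> S\<close> contributes the two edges from \<open>g\<close> to \<open>g s\<close> and to \<open>g s\<^sup>-\<^sup>1\<close>, so that
  every vertex has degree \<open>2 |S|\<close>; a generator with \<open>s = s\<^sup>-\<^sup>1\<close> is counted twice.
\<close>

definition cayley_laplacian ::
    "('a, 'm) monoid_scheme \<Rightarrow> 'a set \<Rightarrow> ('a \<Rightarrow> complex) \<Rightarrow> 'a \<Rightarrow> complex" where
  "cayley_laplacian G S \<phi> g =
     \<phi> g - 1 / (2 * of_nat (card S)) * (\<Sum>s\<in>S. \<phi> (g \<otimes>\<^bsub>G\<^esub> s) + \<phi> (g \<otimes>\<^bsub>G\<^esub> inv\<^bsub>G\<^esub> s))"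

definition laplace_eigenfunction ::
    "('a, 'm) monoid_scheme \<Rightarrow> 'a set \<Rightarrow> ('a \<Rightarrow> complex) \<Rightarrow> bool" where
  "laplace_eigenfunction G S \<phi> \<longleftrightarrow>
     \<phi> \<in> ell2 (carrier G) \<and> (\<exists>g\<in>carrier G. \<phi> g \<noteq> 0) \<and>
     (\<exists>\<mu>::real. \<forall>g\<in>carrier G. cayley_laplacian G S \<phi> g = of_real \<mu> * \<phi> g)"

end

theory Submission
  imports Defs "HOL-Analysis.Convex" "HOL-Analysis.Elementary_Normed_Spaces"
begin

text \<open>
  Write \<open>X\<^sup>n\<close> for the lamp at position \<open>n\<close>. Right multiplication by \<open>a\<close> moves the lamplighter,
  right multiplication by \<open>c\<close> switches the lamp at the current position, and \<open>b\<close> does both: it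
  moves one step to the right and switches the lamp at the new position.

  Generators \<open>a, c\<close>. On an eigenfunction \<open>\<phi>\<close> the eigenvalue equation expresses \<open>\<phi>(\<cdot>, n + 1)\<close> through
  \<open>\<phi>(\<cdot>, n)\<close> and \<open>\<phi>(\<cdot>, n - 1)\<close>. After a Fourier transform in the lamp variable this is a discrete
  Schroedinger equation on the integers with potential \<open>\<plusminus>2\<close>, for which two square-summable solutions
  are proportional because their Wronskian is constant and tends to \<open>0\<close>. A product of transforms
  is the transform of a convolution over the lamp group, so the argument can be carried out
  directly on the group: for two eigenfunctions \<open>\<phi>\<close>, \<open>\<psi>\<close> with the same eigenvalue the convolutions
  \<open>\<phi>(\<cdot>, n) * \<psi>(\<cdot>, k)\<close> and \<open>\<phi>(\<cdot>, k) * \<psi>(\<cdot>, n)\<close> agree (\<open>wronskian_eq_0\<close>). Apply this with \<open>\<psi>\<close> the left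
  translate of \<open>\<phi>\<close> by \<open>(0, -m)\<close>, with \<open>n = 0\<close>, \<open>k = m\<close>, and evaluate at the zero configuration:
  \<open>\<Sum>\<^sub>P \<phi>(P, 0) \<phi>(X\<^bsup>-m\<^esup>P, 0) = \<Sum>\<^sub>P \<phi>(P, m) \<phi>(X\<^bsup>-m\<^esup>P, -m)\<close>.
  As \<open>m\<close> grows, the left-hand side tends to \<open>\<phi>(0, 0)\<^sup>2\<close>, because the shift carries every nonzero
  configuration away (\<open>correlation_tendsto\<close>), and the right-hand side tends to \<open>0\<close>, because
  the slices of \<open>\<phi>\<close> at \<open>m\<close> and \<open>-m\<close> do. So every eigenfunction vanishes at the identity, and by
  left translation it vanishes everywhere.

  Generators \<open>a, b\<close>. Crossing the edge between \<open>n - 1\<close> and \<open>n\<close>, the lamplighter leaves the lamp \<open>n\<close>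
  alone or switches it, with equal weight. A function that is antisymmetric in the lamp \<open>n\<close> cannot
  cross this edge at all; a function that is symmetric in it crosses unchanged. Take functions
  that are antisymmetric in the lamps \<open>i\<close> and \<open>i + m\<close>, symmetric in the lamps strictly between them,
  and concentrated on one configuration of all other lamps: on them the
  sum over the four neighbours is twice the adjacency operator of a path with the \<open>m\<close> vertices \<open>i, \<dots>, i + m - 1\<close>, which is
  diagonalised by sine vectors. The resulting finitely supported eigenfunctions (\<open>mode\<close>) are
  orthonormal: for distinct windows some lamp is symmetric for one and antisymmetric for the
  other function. They are complete because the squares of their values at any group element add
  up to \<open>1\<close>, which is Parseval's identity for a point mass (\<open>hilbert_basisI_point_masses\<close>); the sum
  is a product of two geometric series.
\<close>

section \<open>Square-summable functions\<close>

lemma has_sum_minus: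
  fixes f g :: "'a \<Rightarrow> 'b :: {topological_ab_group_add}"
  assumes "(f has_sum a) A" "(g has_sum b) A"
  shows "((\<lambda>x. f x - g x) has_sum (a - b)) A"
  using has_sum_add[OF assms(1), of "\<lambda>x. - g x" "- b"] assms(2) by (simp add: has_sum_uminus)

lemma ell2_norm_power2: "(ell2_norm A \<phi>)\<^sup>2 = (\<Sum>\<^sub>\<infinity>x\<in>A. (cmod (\<phi> x))\<^sup>2)"
  unfolding ell2_norm_def by (simp add: infsum_nonneg)

lemma ell2_has_sum:
  "\<phi> \<in> ell2 A \<Longrightarrow> ((\<lambda>x. (cmod (\<phi> x))\<^sup>2) has_sum (ell2_norm A \<phi>)\<^sup>2) A"
  unfolding ell2_norm_power2 ell2_def by simp

lemma ell2_comp_bij: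
  assumes "bij_betw T A B"
  shows "(\<lambda>x. \<phi> (T x)) \<in> ell2 A \<longleftrightarrow> \<phi> \<in> ell2 B"
    and "ell2_norm A (\<lambda>x. \<phi> (T x)) = ell2_norm B \<phi>"
  unfolding ell2_def ell2_norm_def
  using summable_on_reindex_bij_betw[OF assms, of "\<lambda>x. (cmod (\<phi> x))\<^sup>2"]
    infsum_reindex_bij_betw[OF assms, of "\<lambda>x. (cmod (\<phi> x))\<^sup>2"] by simp_all

lemma weighted_AM_GM:
  fixes a b t :: real
  assumes "t > 0"
  shows "a * b \<le> t / 2 * a\<^sup>2 + b\<^sup>2 / (2 * t)"
proof -
  have "0 \<le> (t * a - b)\<^sup>2 / (2 * t)"
    using assms by simp
  also have "\<dots> = t / 2 * a\<^sup>2 + b\<^sup>2 / (2 * t) - a * b"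
    using assms by (simp add: field_simps power2_eq_square)
  finally show ?thesis by simp
qed

lemma norm_mult_le_half_squares: "norm (x * y :: complex) \<le> ((cmod x)\<^sup>2 + (cmod y)\<^sup>2) / 2"
  using weighted_AM_GM[of 1 "cmod x" "cmod y"] by (simp add: norm_mult)

lemma ell2_mult_abs_summable:
  assumes "\<phi> \<in> ell2 A" "\<psi> \<in> ell2 A"
  shows "(\<lambda>x. \<phi> x * \<psi> x) abs_summable_on A"
proof (rule abs_summable_on_comparison_test')
  show "(\<lambda>x. ((cmod (\<phi> x))\<^sup>2 + (cmod (\<psi> x))\<^sup>2) / 2) summable_on A"
    by (rule has_sum_imp_summable[OF has_sum_divide_const[OF has_sum_add[OF assms[THEN ell2_has_sum]]]])
qed (rule norm_mult_le_half_squares)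

lemma ell2_mult_summable:
  "\<phi> \<in> ell2 A \<Longrightarrow> \<psi> \<in> ell2 A \<Longrightarrow> (\<lambda>x. \<phi> x * \<psi> x) summable_on A"
  by (rule abs_summable_summable[OF ell2_mult_abs_summable])

lemma norm_infsum_mult_le:
  assumes "\<phi> \<in> ell2 A" "\<psi> \<in> ell2 A"
  shows "norm (\<Sum>\<^sub>\<infinity>x\<in>A. \<phi> x * \<psi> x) \<le> ((ell2_norm A \<phi>)\<^sup>2 + (ell2_norm A \<psi>)\<^sup>2) / 2"
proof (rule norm_infsum_le)
  show "((\<lambda>x. \<phi> x * \<psi> x) has_sum (\<Sum>\<^sub>\<infinity>x\<in>A. \<phi> x * \<psi> x)) A"
    using ell2_mult_summable[OF assms] by simp
  show "((\<lambda>x. ((cmod (\<phi> x))\<^sup>2 + (cmod (\<psi> x))\<^sup>2) / 2) has_sum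
      ((ell2_norm A \<phi>)\<^sup>2 + (ell2_norm A \<psi>)\<^sup>2) / 2) A"
    by (intro has_sum_divide_const has_sum_add ell2_has_sum assms)
qed (rule norm_mult_le_half_squares)

text \<open>
  Truncation to a finite set, phrased with an explicit sum so that the tail can be fed into
  later comparisons of sums.
\<close>

lemma ell2_tail:
  assumes "\<phi> \<in> ell2 A" "\<epsilon> > 0"
  obtains F s where "finite F" "F \<subseteq> A" "s < \<epsilon>"
    "((\<lambda>x. if x \<in> F then 0 else (cmod (\<phi> x))\<^sup>2) has_sum s) A"
proof -
  let ?q = "\<lambda>x. (cmod (\<phi> x))\<^sup>2"
  obtain F where F: "finite F" "F \<subseteq> A" "dist (sum ?q F) ((ell2_norm A \<phi>)\<^sup>2) \<le> \<epsilon> / 2"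
    using has_sum_finite_approximation[OF ell2_has_sum[OF assms(1)], of "\<epsilon> / 2"] assms(2)
    by auto
  have "(?q has_sum ((ell2_norm A \<phi>)\<^sup>2 - sum ?q F)) (A - F)"
    using F by (intro has_sum_Diff ell2_has_sum assms(1) has_sum_finite)
  also have "?this \<longleftrightarrow> ((\<lambda>x. if x \<in> F then 0 else ?q x) has_sum ((ell2_norm A \<phi>)\<^sup>2 - sum ?q F)) A"
    by (intro has_sum_cong_neutral) auto
  finally show ?thesis
    using that[OF F(1,2), rotated] F(3) assms(2) by (force simp: dist_real_def)
qed

text \<open>
  A mixing property: if the maps \<open>T m\<close> fix \<open>z\<close> and push every other point off every finite set, only
  the term at \<open>z\<close> survives in the limit. Outside \<open>z\<close>, for large \<open>m\<close>, one of the two factors lies in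
  the small tail of \<open>f\<close> or of \<open>g\<close>, and a weighted arithmetic-geometric mean inequality lets this small
  factor absorb the bounded one.
\<close>

lemma correlation_tendsto:
  fixes T :: "nat \<Rightarrow> 'a \<Rightarrow> 'a" and f g :: "'a \<Rightarrow> complex"
  assumes f: "f \<in> ell2 UNIV" and g: "g \<in> ell2 UNIV"
    and bij: "\<And>m. bij (T m)"
    and fixed: "\<And>m. T m z = z"
    and wander: "\<And>x y. x \<noteq> z \<Longrightarrow> \<forall>\<^sub>F m in sequentially. T m x \<noteq> y"
  shows "(\<lambda>m. \<Sum>\<^sub>\<infinity>x. f x * g (T m x)) \<longlonglongrightarrow> f z * g z"
proof (rule tendstoI)
  fix e :: real
  assume e: "e > 0"
  define N where "N = (ell2_norm UNIV f)\<^sup>2 + (ell2_norm UNIV g)\<^sup>2 + 1"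
  have N: "N > 0"
    unfolding N_def by (simp add: add_nonneg_pos)
  (* With this weight the bounded factors contribute at most t N / 2 = e / 4; the tails, at
     most t e / 2 each and divided by 2 t, contribute at most e / 2. *)
  define t where "t = e / (2 * N)"
  have t: "t > 0"
    using e N by (simp add: t_def)
  have te: "t * e / 2 > 0"
    using t e by simp
  obtain F s where F: "finite F" "s < t * e / 2"
      "((\<lambda>x. if x \<in> F then 0 else (cmod (f x))\<^sup>2) has_sum s) UNIV"
    using ell2_tail[OF f te] by metis
  obtain G r where G: "finite G" "r < t * e / 2"
      "((\<lambda>x. if x \<in> G then 0 else (cmod (g x))\<^sup>2) has_sum r) UNIV"
    using ell2_tail[OF g te] by metis
  have "\<forall>\<^sub>F m in sequentially. \<forall>x\<in>F - {z}. \<forall>y\<in>G. T m x \<noteq> y"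
    using F(1) G(1) by (intro eventually_ball_finite ballI wander) auto
  then show "\<forall>\<^sub>F m in sequentially. dist (\<Sum>\<^sub>\<infinity>x. f x * g (T m x)) (f z * g z) < e"
  proof eventually_elim
    case (elim m)
    define U where "U = (\<lambda>x. if x \<in> F then 0 else (cmod (f x))\<^sup>2)"
    define V where "V = (\<lambda>x. if x \<in> G then 0 else (cmod (g x))\<^sup>2)"
    have gT: "(\<lambda>x. g (T m x)) \<in> ell2 UNIV" "ell2_norm UNIV (\<lambda>x. g (T m x)) = ell2_norm UNIV g"
      using ell2_comp_bij[OF bij] g by auto
    have V: "((\<lambda>x. V (T m x)) has_sum r) UNIV"
      using has_sum_reindex_bij_betw[OF bij[of m], of V r] G(3) by (simp only: V_def)
    have U: "(U has_sum s) UNIV"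
      using F(3) by (simp add: U_def)
    let ?p = "\<lambda>x. f x * g (T m x)"
    have "((\<lambda>x. if x = z then f z * g z else 0) has_sum f z * g z) UNIV"
      by (rule has_sum_finite_neutralI[of "{z}"]) auto
    then have "((\<lambda>x. ?p x - (if x = z then f z * g z else 0)) has_sum
        (infsum ?p UNIV - f z * g z)) UNIV"
      using ell2_mult_summable[OF f gT(1)] by (intro has_sum_minus) auto
    moreover have "((\<lambda>x. t / 2 * ((cmod (f x))\<^sup>2 + (cmod (g (T m x)))\<^sup>2) + (U x + V (T m x)) / (2 * t))
        has_sum (t / 2 * ((ell2_norm UNIV f)\<^sup>2 + (ell2_norm UNIV (\<lambda>x. g (T m x)))\<^sup>2) + (s + r) / (2 * t))) UNIV"
      by (intro has_sum_add has_sum_cmult_right has_sum_divide_const ell2_has_sum f gT(1) U V)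
    moreover have "norm (?p x - (if x = z then f z * g z else 0))
        \<le> t / 2 * ((cmod (f x))\<^sup>2 + (cmod (g (T m x)))\<^sup>2) + (U x + V (T m x)) / (2 * t)" for x
    proof -
      have UV: "U x \<ge> 0" "V (T m x) \<ge> 0"
        by (simp_all add: U_def V_def)
      consider "x = z" | "x \<noteq> z" "x \<notin> F" | "x \<noteq> z" "T m x \<notin> G"
        using elim by blast
      then show ?thesis
      proof cases
        case 1
        then show ?thesis
          using t UV by (simp add: fixed)
      next
        case 2
        have "cmod (g (T m x)) * cmod (f x) \<le> t / 2 * (cmod (g (T m x)))\<^sup>2 + (cmod (f x))\<^sup>2 / (2 * t)"
          by (rule weighted_AM_GM[OF t])
        moreover have "t / 2 * (cmod (f x))\<^sup>2 \<ge> 0" "V (T m x) / (2 * t) \<ge> 0"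
          using t UV by auto
        ultimately show ?thesis
          using 2 by (simp add: norm_mult U_def add_divide_distrib algebra_simps)
      next
        case 3
        have "cmod (f x) * cmod (g (T m x)) \<le> t / 2 * (cmod (f x))\<^sup>2 + (cmod (g (T m x)))\<^sup>2 / (2 * t)"
          by (rule weighted_AM_GM[OF t])
        moreover have "t / 2 * (cmod (g (T m x)))\<^sup>2 \<ge> 0" "U x / (2 * t) \<ge> 0"
          using t UV by auto
        ultimately show ?thesis
          using 3 by (simp add: norm_mult V_def add_divide_distrib algebra_simps)
      qed
    qed
    ultimately have "norm (infsum ?p UNIV - f z * g z)
        \<le> t / 2 * ((ell2_norm UNIV f)\<^sup>2 + (ell2_norm UNIV g)\<^sup>2) + (s + r) / (2 * t)"
      unfolding gT(2) by (rule norm_infsum_le)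
    also have "\<dots> < t / 2 * N + (t * e) / (2 * t)"
      using t F(2) G(2) by (intro add_strict_mono mult_strict_left_mono divide_strict_right_mono)
        (auto simp: N_def)
    also have "\<dots> \<le> e"
      using t e N by (simp add: t_def)
    finally show ?case
      by (simp add: dist_norm)
  qed
qed

section \<open>Laurent polynomials over the two-element field\<close>

lemma laurent_double [simp]: "P + P = (0 :: laurent_F2)"
proof (rule poly_mapping_eqI)
  fix k
  show "Poly_Mapping.lookup (P + P) k = Poly_Mapping.lookup 0 k"
    unfolding lookup_add lookup_zero by (cases "Poly_Mapping.lookup P k") simp_all
qed

lemma laurent_two [simp]: "2 = (0 :: laurent_F2)"
  using laurent_double[of 1] by (simp only: one_add_one)

lemma laurent_add_cancel [simp]: "P + R + R = (P :: laurent_F2)"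
  by (simp add: add.assoc)

lemma lookup_X_pow: "Poly_Mapping.lookup (X_pow n) k = (if k = n then 1 else 0)"
  by (auto simp: X_pow_def lookup_single when_def)

lemma lookup_X_pow_mult: "Poly_Mapping.lookup (X_pow n * P) k = Poly_Mapping.lookup P (k - n)"
proof (induction P rule: Poly_Mapping.update_induct)
  case const
  show ?case by simp
next
  case (update f i v)
  have "Poly_Mapping.update i v f = Poly_Mapping.single i v + f"
    using update(1) by (intro poly_mapping_eqI)
      (auto simp: lookup_add lookup_update lookup_single in_keys_iff)
  then have "Poly_Mapping.lookup (X_pow n * Poly_Mapping.update i v f) k
      = Poly_Mapping.lookup (Poly_Mapping.single (n + i) v) k + Poly_Mapping.lookup f (k - n)"
    using update(3) by (simp only: distrib_left lookup_add) (simp add: X_pow_def mult_single)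
  also have "\<dots> = Poly_Mapping.lookup (Poly_Mapping.update i v f) (k - n)"
    using update(1) by (auto simp: lookup_update lookup_single when_def in_keys_iff)
  finally show ?case .
qed

text \<open>
  The hypothesis of the mixing property for the shift of configurations: a lit lamp of \<open>P\<close> is
  eventually moved to the left of all lit lamps of \<open>Q\<close>.
\<close>

lemma X_pow_mult_wanders:
  assumes "P \<noteq> 0"
  shows "\<forall>\<^sub>F m in sequentially. X_pow (- int m) * P \<noteq> Q"
proof -
  obtain k where k: "k \<in> Poly_Mapping.keys P"
    using assms by (metis ex_in_conv keys_eq_empty)
  have "finite ((\<lambda>i. nat (k - i)) ` Poly_Mapping.keys Q)"
    by simp
  then obtain M where M: "\<And>i. i \<in> Poly_Mapping.keys Q \<Longrightarrow> nat (k - i) < M"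
    unfolding finite_nat_set_iff_bounded by auto
  have "X_pow (- int m) * P \<noteq> Q" if "m \<ge> M" for m
  proof
    assume "X_pow (- int m) * P = Q"
    then have "Poly_Mapping.lookup Q (k - int m) = Poly_Mapping.lookup P k"
      using lookup_X_pow_mult[of "- int m" P "k - int m"] by simp
    then have "k - int m \<in> Poly_Mapping.keys Q"
      using k by (simp add: in_keys_iff)
    from M[OF this] that show False by simp
  qed
  then show ?thesis
    unfolding eventually_sequentially by blast
qed

lemma bij_X_pow_mult: "bij (\<lambda>P. X_pow n * P)"
  by (rule bij_betw_byWitness[where f' = "\<lambda>P. X_pow (- n) * P"])
    (auto simp: X_pow_0 simp flip: mult.assoc X_pow_add)

section \<open>Translation invariance of the Laplacian\<close>

lemma bij_betw_left_translation:
  assumes "group G" "g \<in> carrier G"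
  shows "bij_betw (\<lambda>h. g \<otimes>\<^bsub>G\<^esub> h) (carrier G) (carrier G)"
proof -
  interpret group G by fact
  show ?thesis
    using assms(2) inj_on_cmult surj_const_mult by (simp add: bij_betw_def)
qed

lemma laplace_eigenfunction_translate:
  assumes "group G" "S \<subseteq> carrier G" "g \<in> carrier G"
    and eigen: "laplace_eigenfunction G S \<phi>"
  shows "laplace_eigenfunction G S (\<lambda>h. \<phi> (g \<otimes>\<^bsub>G\<^esub> h))"
proof -
  interpret group G by fact
  note bij = bij_betw_left_translation[OF assms(1,3)]
  obtain \<mu> :: real where
    mu: "\<And>h. h \<in> carrier G \<Longrightarrow> cayley_laplacian G S \<phi> h = of_real \<mu> * \<phi> h"
    using eigen unfolding laplace_eigenfunction_def by blast
  have "cayley_laplacian G S (\<lambda>h. \<phi> (g \<otimes>\<^bsub>G\<^esub> h)) h = cayley_laplacian G S \<phi> (g \<otimes>\<^bsub>G\<^esub> h)"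
    if "h \<in> carrier G" for h
    using assms(2,3) that
    by (auto simp: cayley_laplacian_def m_assoc subset_iff intro!: arg_cong2[where f = times] sum.cong)
  then have "cayley_laplacian G S (\<lambda>h. \<phi> (g \<otimes>\<^bsub>G\<^esub> h)) h = of_real \<mu> * \<phi> (g \<otimes>\<^bsub>G\<^esub> h)"
    if "h \<in> carrier G" for h
    using that assms(3) mu by simp
  moreover have "\<exists>h\<in>carrier G. \<phi> (g \<otimes>\<^bsub>G\<^esub> h) \<noteq> 0"
    using eigen bij unfolding laplace_eigenfunction_def bij_betw_def by (metis imageE)
  ultimately show ?thesis
    using eigen ell2_comp_bij(1)[OF bij] unfolding laplace_eigenfunction_def by blast
qed

section \<open>Absence of eigenfunctions for the generators walk and switch\<close>

text \<open>
  The difference of the convolutions over the lamp group of the slices \<open>\<phi>(\<cdot>, n)\<close>, \<open>\<psi>(\<cdot>, k)\<close> and of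
  \<open>\<phi>(\<cdot>, k)\<close>, \<open>\<psi>(\<cdot>, n)\<close>, at the configuration \<open>R\<close>; since the lamp group has exponent two, \<open>P + R\<close>
  stands for \<open>R - P\<close>. Its Fourier transform in \<open>R\<close> is the \<open>2 \<times> 2\<close> determinant formed from the
  transforms of \<open>\<phi>\<close> and \<open>\<psi>\<close> at positions \<open>n\<close> and \<open>k\<close>.
\<close>

definition wronskian ::
  "(laurent_F2 \<times> int \<Rightarrow> complex) \<Rightarrow> (laurent_F2 \<times> int \<Rightarrow> complex) \<Rightarrow> int \<Rightarrow> int \<Rightarrow> laurent_F2 \<Rightarrow> complex"
where
  "wronskian \<phi> \<psi> n k R =
     (\<Sum>\<^sub>\<infinity>P. \<phi> (P, n) * \<psi> (P + R, k)) - (\<Sum>\<^sub>\<infinity>P. \<phi> (P, k) * \<psi> (P + R, n))"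

lemma ell2_slice:
  fixes \<phi> :: "'a \<times> int \<Rightarrow> complex"
  assumes "\<phi> \<in> ell2 UNIV"
  shows "(\<lambda>P. \<phi> (P, n)) \<in> ell2 UNIV"
proof -
  have "(\<lambda>x. (cmod (\<phi> x))\<^sup>2) summable_on (\<lambda>P. (P, n)) ` UNIV"
    using assms unfolding ell2_def by (auto intro: summable_on_subset_banach)
  then show ?thesis
    unfolding ell2_def by (subst (asm) summable_on_reindex) (auto simp: inj_on_def o_def)
qed

lemma ell2_slice_shift:
  fixes \<phi> :: "laurent_F2 \<times> int \<Rightarrow> complex"
  assumes "\<phi> \<in> ell2 UNIV"
  shows "(\<lambda>P. \<phi> (P + R, n)) \<in> ell2 UNIV"
    and "ell2_norm UNIV (\<lambda>P. \<phi> (P + R, n)) = ell2_norm UNIV (\<lambda>P. \<phi> (P, n))"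
proof -
  have bij: "bij (\<lambda>P. P + R)"
    by (rule bij_betw_byWitness[where f' = "\<lambda>P. P + R"]) auto
  show "(\<lambda>P. \<phi> (P + R, n)) \<in> ell2 UNIV"
    using ell2_comp_bij(1)[OF bij, of "\<lambda>P. \<phi> (P, n)"] ell2_slice[OF assms] by simp
  show "ell2_norm UNIV (\<lambda>P. \<phi> (P + R, n)) = ell2_norm UNIV (\<lambda>P. \<phi> (P, n))"
    using ell2_comp_bij(2)[OF bij, of "\<lambda>P. \<phi> (P, n)"] by simp
qed

lemma ell2_slice_norm_tendsto_0:
  fixes \<phi> :: "'a \<times> int \<Rightarrow> complex" and N :: "nat \<Rightarrow> int"
  assumes "\<phi> \<in> ell2 UNIV" "inj N"
  shows "(\<lambda>m. (ell2_norm UNIV (\<lambda>P. \<phi> (P, N m)))\<^sup>2) \<longlonglongrightarrow> 0"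
proof -
  have "(\<lambda>x. (cmod (\<phi> x))\<^sup>2) summable_on (\<lambda>(n, P). (P, n)) ` UNIV"
    using assms(1) unfolding ell2_def by (auto intro: summable_on_subset_banach)
  then have "(\<lambda>(n, P). (cmod (\<phi> (P, n)))\<^sup>2) summable_on UNIV"
    by (subst (asm) summable_on_reindex) (auto simp: inj_on_def o_def case_prod_unfold)
  then have "(\<lambda>n. \<Sum>\<^sub>\<infinity>P. (cmod (\<phi> (P, n)))\<^sup>2) summable_on UNIV"
    using summable_on_Sigma_banach[of "\<lambda>n P. (cmod (\<phi> (P, n)))\<^sup>2" UNIV "\<lambda>_. UNIV"] by simp
  then have "(\<lambda>n. (ell2_norm UNIV (\<lambda>P. \<phi> (P, n)))\<^sup>2) summable_on range N"
    unfolding ell2_norm_power2 by (auto intro: summable_on_subset_banach)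
  then have "(\<lambda>m. (ell2_norm UNIV (\<lambda>P. \<phi> (P, N m)))\<^sup>2) summable_on UNIV"
    by (subst (asm) summable_on_reindex) (auto simp: assms(2) o_def)
  then have "summable (\<lambda>m. (ell2_norm UNIV (\<lambda>P. \<phi> (P, N m)))\<^sup>2)"
    by (subst (asm) summable_on_UNIV_nonneg_real_iff) auto
  then show ?thesis
    by (rule summable_LIMSEQ_zero)
qed

text \<open>
  The eigenvalue equation for the generators \<open>a, c\<close>, solved for the value one step to the right;
  an eigenvalue \<open>\<mu>\<close> corresponds to \<open>\<kappa> = 4 (1 - \<mu>)\<close>. The coefficient \<open>2\<close> appears because \<open>c\<close> is its own
  inverse.
\<close>

definition switch_walk_recurrence :: "complex \<Rightarrow> (laurent_F2 \<times> int \<Rightarrow> complex) \<Rightarrow> bool" where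
  "switch_walk_recurrence \<kappa> \<phi> \<longleftrightarrow>
     (\<forall>P n. \<phi> (P, n + 1) = \<kappa> * \<phi> (P, n) - 2 * \<phi> (P + X_pow n, n) - \<phi> (P, n - 1))"

text \<open>
  Convolution commutes with the switch of a lamp, so in its second position the Wronskian
  satisfies the same recurrence as the two functions.
\<close>

lemma wronskian_step:
  assumes phi: "\<phi> \<in> ell2 UNIV" "switch_walk_recurrence \<kappa> \<phi>"
    and psi: "\<psi> \<in> ell2 UNIV" "switch_walk_recurrence \<kappa> \<psi>"
  shows "wronskian \<phi> \<psi> n (k + 1) R
    = \<kappa> * wronskian \<phi> \<psi> n k R - 2 * wronskian \<phi> \<psi> n k (R + X_pow k) - wronskian \<phi> \<psi> n (k - 1) R"
proof -
  let ?c = "\<lambda>i j R. \<Sum>\<^sub>\<infinity>P. \<phi> (P, i) * \<psi> (P + R, j)"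
  have hs: "((\<lambda>P. \<phi> (P, i) * \<psi> (P + R, j)) has_sum ?c i j R) UNIV" for i j R
    by (intro has_sum_infsum ell2_mult_summable ell2_slice ell2_slice_shift phi psi)
  (* Moving the switch of lamp k from one factor of the convolution to the other. *)
  have hs': "((\<lambda>P. \<phi> (P + X_pow k, k) * \<psi> (P + R, n)) has_sum ?c k n (R + X_pow k)) UNIV"
  proof -
    have bij: "bij (\<lambda>P. P + X_pow k)"
      by (rule bij_betw_byWitness[where f' = "\<lambda>P. P + X_pow k"]) auto
    have "P + X_pow k + (R + X_pow k) = P + R" for P :: laurent_F2
      using laurent_add_cancel[of "P + R" "X_pow k"] by (simp add: ac_simps)
    then show ?thesis
      using has_sum_reindex_bij_betw[OF bij, of "\<lambda>P. \<phi> (P, k) * \<psi> (P + (R + X_pow k), n)"] hs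
      by simp
  qed
  have "((\<lambda>P. \<kappa> * (\<phi> (P, n) * \<psi> (P + R, k)) - 2 * (\<phi> (P, n) * \<psi> (P + (R + X_pow k), k))
      - \<phi> (P, n) * \<psi> (P + R, k - 1)) has_sum
      (\<kappa> * ?c n k R - 2 * ?c n k (R + X_pow k) - ?c n (k - 1) R)) UNIV"
    by (intro has_sum_minus has_sum_cmult_right hs)
  moreover have "\<psi> (P, k + 1) = \<kappa> * \<psi> (P, k) - 2 * \<psi> (P + X_pow k, k) - \<psi> (P, k - 1)" for P
    using psi(2) unfolding switch_walk_recurrence_def by blast
  ultimately have 1: "?c n (k + 1) R = \<kappa> * ?c n k R - 2 * ?c n k (R + X_pow k) - ?c n (k - 1) R"
    by (intro infsumI) (simp add: right_diff_distrib ac_simps)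
  have "((\<lambda>P. \<kappa> * (\<phi> (P, k) * \<psi> (P + R, n)) - 2 * (\<phi> (P + X_pow k, k) * \<psi> (P + R, n))
      - \<phi> (P, k - 1) * \<psi> (P + R, n)) has_sum
      (\<kappa> * ?c k n R - 2 * ?c k n (R + X_pow k) - ?c (k - 1) n R)) UNIV"
    by (intro has_sum_minus has_sum_cmult_right hs hs')
  moreover have "\<phi> (P, k + 1) = \<kappa> * \<phi> (P, k) - 2 * \<phi> (P + X_pow k, k) - \<phi> (P, k - 1)" for P
    using phi(2) unfolding switch_walk_recurrence_def by blast
  ultimately have 2: "?c (k + 1) n R = \<kappa> * ?c k n R - 2 * ?c k n (R + X_pow k) - ?c (k - 1) n R"
    by (intro infsumI) (simp add: left_diff_distrib mult.assoc)
  show ?thesis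
    unfolding wronskian_def 1 2 by (simp add: algebra_simps)
qed

lemma wronskian_diag: "wronskian \<phi> \<psi> n n R = 0"
  by (simp add: wronskian_def)

lemma wronskian_swap: "wronskian \<phi> \<psi> n k R = - wronskian \<phi> \<psi> k n R"
  by (simp add: wronskian_def)

text \<open>
  Constancy of the Wronskian: the recurrence and antisymmetry give
  \<open>wronskian \<phi> \<psi> n (n + 1) = wronskian \<phi> \<psi> (n - 1) n\<close>. The constant is \<open>0\<close> since it is bounded by the
  squared norms of slices of \<open>\<phi>\<close> and \<open>\<psi>\<close>, which tend to \<open>0\<close>.
\<close>

lemma wronskian_neighbours_eq_0:
  assumes phi: "\<phi> \<in> ell2 UNIV" "switch_walk_recurrence \<kappa> \<phi>"
    and psi: "\<psi> \<in> ell2 UNIV" "switch_walk_recurrence \<kappa> \<psi>"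
  shows "wronskian \<phi> \<psi> 0 1 R = 0"
proof -
  have step: "wronskian \<phi> \<psi> n (n + 1) R = wronskian \<phi> \<psi> (n - 1) n R" for n
    using wronskian_step[OF assms, of n n R] wronskian_swap[of \<phi> \<psi> n "n - 1" R]
    by (simp add: wronskian_diag)
  have const: "wronskian \<phi> \<psi> (int m) (int m + 1) R = wronskian \<phi> \<psi> 0 1 R" for m :: nat
  proof (induction m)
    case (Suc m)
    then show ?case
      using step[of "int m + 1"] by (simp add: add.commute)
  qed simp
  let ?q = "\<lambda>\<phi> n. (ell2_norm UNIV (\<lambda>P. \<phi> (P, n :: int)))\<^sup>2"
  let ?b = "\<lambda>m. (?q \<phi> (int m) + ?q \<psi> (int m + 1)) / 2 + (?q \<phi> (int m + 1) + ?q \<psi> (int m)) / 2"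
  have bound: "\<forall>m. norm (wronskian \<phi> \<psi> (int m) (int m + 1) R) \<le> ?b m"
  proof
    fix m
    have le: "norm (\<Sum>\<^sub>\<infinity>P. \<phi> (P, i) * \<psi> (P + R, j)) \<le> (?q \<phi> i + ?q \<psi> j) / 2" for i j
      using norm_infsum_mult_le[OF ell2_slice[OF phi(1)] ell2_slice_shift(1)[OF psi(1)]]
      by (simp only: ell2_slice_shift(2)[OF psi(1)])
    show "norm (wronskian \<phi> \<psi> (int m) (int m + 1) R) \<le> ?b m"
      unfolding wronskian_def by (rule order_trans[OF norm_triangle_ineq4 add_mono[OF le le]])
  qed
  have "?b \<longlonglongrightarrow> (0 + 0) / 2 + (0 + 0) / 2"
    by (intro tendsto_add tendsto_divide tendsto_const ell2_slice_norm_tendsto_0 phi psi)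
      (auto simp: inj_def)
  then have "?b \<longlonglongrightarrow> 0"
    by simp
  then have "(\<lambda>m. wronskian \<phi> \<psi> (int m) (int m + 1) R) \<longlonglongrightarrow> 0"
    by (rule Lim_null_comparison[OF always_eventually[OF bound]])
  then show ?thesis
    unfolding const by (simp add: LIMSEQ_const_iff)
qed

lemma wronskian_eq_0:
  assumes phi: "\<phi> \<in> ell2 UNIV" "switch_walk_recurrence \<kappa> \<phi>"
    and psi: "\<psi> \<in> ell2 UNIV" "switch_walk_recurrence \<kappa> \<psi>"
  shows "wronskian \<phi> \<psi> 0 (int m) R = 0"
proof -
  have "(\<forall>R. wronskian \<phi> \<psi> 0 (int m) R = 0) \<and> (\<forall>R. wronskian \<phi> \<psi> 0 (int m + 1) R = 0)"
  proof (induction m)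
    case 0
    show ?case
      using wronskian_neighbours_eq_0[OF assms] by (simp add: wronskian_diag)
  next
    case (Suc m)
    then show ?case
      using wronskian_step[OF assms, of 0 "int m + 1"] by (simp add: add.commute)
  qed
  then show ?thesis by blast
qed

text \<open>
  A solution is compared with its own translates by powers of \<open>a\<close>, because these bring in the
  shift of configurations and with it the mixing property.
\<close>

lemma switch_walk_vanishes_at_one:
  assumes phi: "\<phi> \<in> ell2 UNIV" "switch_walk_recurrence \<kappa> \<phi>"
  shows "\<phi> (0, 0) = 0"
proof -
  define T where "T m P = X_pow (- int m) * P" for m P
  define \<psi> where "\<psi> m = (\<lambda>(P, n). \<phi> (T m P, n - int m))" for m
  have psi_ell2: "\<psi> m \<in> ell2 UNIV" for m
  proof -
    have "(\<lambda>h. \<phi> ((0, - int m) \<otimes>\<^bsub>lamplighter\<^esub> h)) \<in> ell2 (carrier lamplighter)"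
      using ell2_comp_bij(1)[OF bij_betw_left_translation[OF group_lamplighter]] phi(1) by simp
    moreover have "(\<lambda>h. \<phi> ((0, - int m) \<otimes>\<^bsub>lamplighter\<^esub> h)) = \<psi> m"
      by (auto simp: \<psi>_def T_def fun_eq_iff)
    ultimately show ?thesis by simp
  qed
  have psi_rec: "switch_walk_recurrence \<kappa> (\<psi> m)" for m
  proof -
    have "T m (P + X_pow n) = T m P + X_pow (n - int m)" for P n
      by (simp add: T_def distrib_left flip: X_pow_add)
    then show ?thesis
      using phi(2)[unfolded switch_walk_recurrence_def, rule_format, of "T m P" "n - int m" for P n]
      by (simp add: switch_walk_recurrence_def \<psi>_def algebra_simps)
  qed
  have eq: "(\<Sum>\<^sub>\<infinity>P. \<phi> (P, 0) * \<phi> (T m P, 0)) = (\<Sum>\<^sub>\<infinity>P. \<phi> (P, int m) * \<phi> (T m P, - int m))" for m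
    using wronskian_eq_0[OF phi psi_ell2[of m] psi_rec[of m], of m 0]
    by (simp add: wronskian_def \<psi>_def)
  have "(\<lambda>m. \<Sum>\<^sub>\<infinity>P. \<phi> (P, 0) * \<phi> (T m P, 0)) \<longlonglongrightarrow> \<phi> (0, 0) * \<phi> (0, 0)"
    by (rule correlation_tendsto[where f = "\<lambda>P. \<phi> (P, 0)" and g = "\<lambda>P. \<phi> (P, 0)"])
      (auto simp: T_def intro!: ell2_slice phi bij_X_pow_mult X_pow_mult_wanders)
  moreover have "(\<lambda>m. \<Sum>\<^sub>\<infinity>P. \<phi> (P, int m) * \<phi> (T m P, - int m)) \<longlonglongrightarrow> 0"
  proof (rule Lim_null_comparison[OF always_eventually])
    let ?q = "\<lambda>n. (ell2_norm UNIV (\<lambda>P. \<phi> (P, n)))\<^sup>2"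
    have T: "(\<lambda>P. \<phi> (T m P, n)) \<in> ell2 UNIV"
        "ell2_norm UNIV (\<lambda>P. \<phi> (T m P, n)) = ell2_norm UNIV (\<lambda>P. \<phi> (P, n))" for m n
      unfolding T_def using ell2_comp_bij[OF bij_X_pow_mult, of "\<lambda>P. \<phi> (P, n)"]
        ell2_slice[OF phi(1)] by auto
    show "\<forall>m. norm (\<Sum>\<^sub>\<infinity>P. \<phi> (P, int m) * \<phi> (T m P, - int m)) \<le> (?q (int m) + ?q (- int m)) / 2"
      using norm_infsum_mult_le[OF ell2_slice[OF phi(1)] T(1)] by (simp add: T(2))
    have "(\<lambda>m. (?q (int m) + ?q (- int m)) / 2) \<longlonglongrightarrow> (0 + 0) / 2"
      by (intro tendsto_add tendsto_divide tendsto_const ell2_slice_norm_tendsto_0 phi)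
        (auto simp: inj_def)
    then show "(\<lambda>m. (?q (int m) + ?q (- int m)) / 2) \<longlonglongrightarrow> 0" by simp
  qed
  ultimately have "\<phi> (0, 0) * \<phi> (0, 0) = 0"
    unfolding eq by (rule LIMSEQ_unique)
  then show ?thesis by simp
qed

lemma no_switch_walk_eigenfunction:
  "\<not> laplace_eigenfunction lamplighter {(0, 1), (1, 0)} \<phi>"
proof
  let ?S = "{(0, 1), (1, 0)} :: (laurent_F2 \<times> int) set"
  assume eigen: "laplace_eigenfunction lamplighter ?S \<phi>"
  then obtain g where g: "\<phi> g \<noteq> 0"
    unfolding laplace_eigenfunction_def by blast
  define \<psi> where "\<psi> h = \<phi> (g \<otimes>\<^bsub>lamplighter\<^esub> h)" for h
  have psi: "laplace_eigenfunction lamplighter ?S \<psi>"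
    unfolding \<psi>_def by (rule laplace_eigenfunction_translate[OF group_lamplighter _ _ eigen]) auto
  then obtain \<mu> :: real where
    mu: "\<And>h. cayley_laplacian lamplighter ?S \<psi> h = of_real \<mu> * \<psi> h"
    unfolding laplace_eigenfunction_def by auto
  have neg: "- P = P" for P :: laurent_F2
    by (simp add: neg_eq_iff_add_eq_0)
  have "cayley_laplacian lamplighter ?S \<psi> (P, n)
      = \<psi> (P, n) - 1 / 4 * (\<psi> (P, n + 1) + \<psi> (P, n - 1) + 2 * \<psi> (P + X_pow n, n))" for P n
    by (simp add: cayley_laplacian_def inv_lamplighter X_pow_0 neg card_insert_if)
  with mu have "\<psi> (P, n) - 1 / 4 * (\<psi> (P, n + 1) + \<psi> (P, n - 1) + 2 * \<psi> (P + X_pow n, n))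
      = of_real \<mu> * \<psi> (P, n)" for P n
    by metis
  then have "switch_walk_recurrence (4 * (1 - of_real \<mu>)) \<psi>"
    unfolding switch_walk_recurrence_def by (simp add: field_simps)
  moreover have "\<psi> \<in> ell2 UNIV"
    using psi by (simp add: laplace_eigenfunction_def)
  ultimately have "\<psi> (0, 0) = 0"
    by (rule switch_walk_vanishes_at_one[rotated])
  with g show False
    by (cases g) (simp add: \<psi>_def)
qed

section \<open>A criterion for Hilbert bases\<close>

lemma has_sum_sum_finite:
  fixes f :: "'i \<Rightarrow> 'a \<Rightarrow> 'b :: topological_comm_monoid_add"
  assumes "\<And>i. i \<in> I \<Longrightarrow> (f i has_sum s i) A"
  shows "((\<lambda>x. \<Sum>i\<in>I. f i x) has_sum (\<Sum>i\<in>I. s i)) A"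
  using assms by (induction I rule: infinite_finite_induct) (auto intro!: has_sum_add)

lemma ell2_norm_power2_le:
  assumes "(h has_sum s) A" "\<And>x. x \<in> A \<Longrightarrow> (cmod (\<phi> x))\<^sup>2 \<le> h x"
  shows "(ell2_norm A \<phi>)\<^sup>2 \<le> s"
proof -
  have "\<phi> \<in> ell2 A"
    unfolding ell2_def using assms
    by (auto intro: summable_on_comparison_test[OF has_sum_imp_summable])
  then show ?thesis
    using has_sum_mono[OF ell2_has_sum assms(1)] assms(2) by blast
qed

lemma ell2_inner_has_sum:
  assumes "\<phi> \<in> ell2 A" "\<psi> \<in> ell2 A"
  shows "((\<lambda>x. \<phi> x * cnj (\<psi> x)) has_sum ell2_inner A \<phi> \<psi>) A"
proof -
  have "(\<lambda>x. cnj (\<psi> x)) \<in> ell2 A"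
    using assms(2) by (simp add: ell2_def)
  from ell2_mult_summable[OF assms(1) this] show ?thesis
    unfolding ell2_inner_def by (rule has_sum_infsum)
qed

text \<open>
  Pythagoras for the orthogonal projection of the point mass at \<open>x\<close> to the span of \<open>F\<close>: the
  coefficient of the point mass along \<open>\<beta>\<close> is \<open>cnj (\<beta> x)\<close>.
\<close>

lemma point_mass_residual:
  assumes B: "F \<subseteq> ell2 A" "finite F"
    and orth: "\<And>\<phi> \<psi>. \<phi> \<in> F \<Longrightarrow> \<psi> \<in> F \<Longrightarrow> ell2_inner A \<phi> \<psi> = (if \<phi> = \<psi> then 1 else 0)"
    and x: "x \<in> A"
  shows "((\<lambda>y. (cmod ((if y = x then 1 else 0) - (\<Sum>\<beta>\<in>F. cnj (\<beta> x) * \<beta> y)))\<^sup>2)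
    has_sum (1 - (\<Sum>\<beta>\<in>F. (cmod (\<beta> x))\<^sup>2))) A"
proof -
  let ?g = "\<lambda>y. \<Sum>\<beta>\<in>F. cnj (\<beta> x) * \<beta> y"
  (* The cross terms of the square only live at y = x, where ?g takes the real value ?\<sigma>. *)
  let ?\<sigma> = "\<Sum>\<beta>\<in>F. (cmod (\<beta> x))\<^sup>2"
  have gx: "?g x = of_real ?\<sigma>"
    by (simp only: of_real_sum complex_norm_square mult.commute)
  have "((\<lambda>y. \<Sum>\<beta>\<in>F. \<Sum>\<gamma>\<in>F. cnj (\<beta> x) * \<gamma> x * (\<beta> y * cnj (\<gamma> y))) has_sum
      (\<Sum>\<beta>\<in>F. \<Sum>\<gamma>\<in>F. cnj (\<beta> x) * \<gamma> x * ell2_inner A \<beta> \<gamma>)) A"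
    by (rule has_sum_sum_finite, rule has_sum_sum_finite, rule has_sum_cmult_right, rule ell2_inner_has_sum)
      (use B in auto)
  moreover have "(\<Sum>\<beta>\<in>F. \<Sum>\<gamma>\<in>F. cnj (\<beta> x) * \<gamma> x * ell2_inner A \<beta> \<gamma>) = of_real ?\<sigma>"
  proof -
    have "(\<Sum>\<gamma>\<in>F. cnj (\<beta> x) * \<gamma> x * ell2_inner A \<beta> \<gamma>) = of_real ((cmod (\<beta> x))\<^sup>2)" if "\<beta> \<in> F" for \<beta>
    proof -
      have "(\<Sum>\<gamma>\<in>F. cnj (\<beta> x) * \<gamma> x * ell2_inner A \<beta> \<gamma>)
          = (\<Sum>\<gamma>\<in>F. if \<gamma> = \<beta> then cnj (\<beta> x) * \<beta> x else 0)"
        using orth that by (intro sum.cong) auto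
      also have "\<dots> = cnj (\<beta> x) * \<beta> x"
        using that B(2) by simp
      finally show ?thesis
        by (simp only: complex_norm_square mult.commute)
    qed
    then show ?thesis by simp
  qed
  moreover have "(\<Sum>\<beta>\<in>F. \<Sum>\<gamma>\<in>F. cnj (\<beta> x) * \<gamma> x * (\<beta> y * cnj (\<gamma> y))) = ?g y * cnj (?g y)" for y
    unfolding cnj_sum sum_product by (intro sum.cong refl) (simp add: ac_simps)
  ultimately have "((\<lambda>y. ?g y * cnj (?g y)) has_sum of_real ?\<sigma>) A"
    by simp
  moreover have "((\<lambda>y. if y = x then 1 - 2 * complex_of_real ?\<sigma> else 0) has_sum
      (1 - 2 * complex_of_real ?\<sigma>)) A"
    using x by (intro has_sum_finite_neutralI[of "{x}"]) auto
  ultimately have "((\<lambda>y. (if y = x then 1 - 2 * complex_of_real ?\<sigma> else 0) + ?g y * cnj (?g y)) has_sum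
      (1 - 2 * complex_of_real ?\<sigma> + of_real ?\<sigma>)) A"
    by (rule has_sum_add[rotated])
  moreover have "(if y = x then 1 - 2 * complex_of_real ?\<sigma> else 0) + ?g y * cnj (?g y)
      = of_real ((cmod ((if y = x then 1 else 0) - ?g y))\<^sup>2)" for y
  proof (cases "y = x")
    case True
    then show ?thesis
      unfolding complex_norm_square True gx by (simp add: algebra_simps)
  next
    case False
    then show ?thesis
      unfolding complex_norm_square by (simp add: algebra_simps)
  qed
  ultimately have "((\<lambda>y. complex_of_real ((cmod ((if y = x then 1 else 0) - ?g y))\<^sup>2)) has_sum
      of_real (1 - ?\<sigma>)) A"
    by simp
  then show ?thesis
    by (simp only: has_sum_of_real_iff)
qed

text \<open>
  Completeness can be tested on point masses, since they span a dense subspace, and for a point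
  mass Parseval's identity is a statement about the values of the basis functions at one point.
  An arbitrary \<open>\<phi>\<close> is truncated to a finite set \<open>X\<close>, and the point masses in \<open>X\<close> are replaced by their
  projections to a common finite set of basis functions.
\<close>

lemma hilbert_basisI_point_masses:
  assumes B: "B \<subseteq> ell2 A"
    and orth: "\<And>\<phi> \<psi>. \<phi> \<in> B \<Longrightarrow> \<psi> \<in> B \<Longrightarrow> ell2_inner A \<phi> \<psi> = (if \<phi> = \<psi> then 1 else 0)"
    and parseval: "\<And>x \<eta>. x \<in> A \<Longrightarrow> \<eta> > 0 \<Longrightarrow>
      \<exists>F. finite F \<and> F \<subseteq> B \<and> 1 - \<eta> < (\<Sum>\<beta>\<in>F. (cmod (\<beta> x))\<^sup>2)"
  shows "hilbert_basis A B"
  unfolding hilbert_basis_def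
proof (intro conjI ballI allI impI)
  fix \<phi> :: "'a \<Rightarrow> complex" and \<epsilon> :: real
  assume phi: "\<phi> \<in> ell2 A" and eps: "\<epsilon> > 0"
  obtain X r where X: "finite X" "X \<subseteq> A" "r < \<epsilon>\<^sup>2 / 4"
      "((\<lambda>y. if y \<in> X then 0 else (cmod (\<phi> y))\<^sup>2) has_sum r) A"
    using ell2_tail[OF phi, of "\<epsilon>\<^sup>2 / 4"] eps by auto
  define C where "C = (\<Sum>x\<in>X. (cmod (\<phi> x))\<^sup>2)"
  (* The residuals of the point masses enter with total weight card X * C; adding 1 keeps the
     denominator of the tolerance positive when this weight vanishes. *)
  define M where "M = real (card X) * C + 1"
  define \<eta> where "\<eta> = \<epsilon>\<^sup>2 / (4 * M)"
  have "C \<ge> 0"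
    unfolding C_def by (intro sum_nonneg) auto
  then have M: "M > 0"
    unfolding M_def by (intro add_nonneg_pos) auto
  have eta: "\<eta> > 0" "M * \<eta> = \<epsilon>\<^sup>2 / 4"
    using eps M by (simp_all add: \<eta>_def)
  have "\<forall>x\<in>X. \<exists>F. finite F \<and> F \<subseteq> B \<and> 1 - \<eta> < (\<Sum>\<beta>\<in>F. (cmod (\<beta> x))\<^sup>2)"
  proof
    fix x assume "x \<in> X"
    then show "\<exists>F. finite F \<and> F \<subseteq> B \<and> 1 - \<eta> < (\<Sum>\<beta>\<in>F. (cmod (\<beta> x))\<^sup>2)"
      using X(2) by (intro parseval eta(1)) auto
  qed
  from bchoice[OF this] obtain K where
    K: "\<And>x. x \<in> X \<Longrightarrow> finite (K x) \<and> K x \<subseteq> B \<and> 1 - \<eta> < (\<Sum>\<beta>\<in>K x. (cmod (\<beta> x))\<^sup>2)"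
    by blast
  define F where "F = (\<Union>x\<in>X. K x)"
  have F: "finite F" "F \<subseteq> B"
    using K X(1) by (auto simp: F_def)
  have F_eta: "1 - (\<Sum>\<beta>\<in>F. (cmod (\<beta> x))\<^sup>2) \<le> \<eta>" if "x \<in> X" for x
  proof -
    have "(\<Sum>\<beta>\<in>K x. (cmod (\<beta> x))\<^sup>2) \<le> (\<Sum>\<beta>\<in>F. (cmod (\<beta> x))\<^sup>2)"
      using that F(1) by (intro sum_mono2) (auto simp: F_def)
    then show ?thesis
      using K[OF that] by linarith
  qed
  define e where "e x y = (if y = x then 1 else 0) - (\<Sum>\<beta>\<in>F. cnj (\<beta> x) * \<beta> y)" for x y
  have e: "((\<lambda>y. (cmod (e x y))\<^sup>2) has_sum (1 - (\<Sum>\<beta>\<in>F. (cmod (\<beta> x))\<^sup>2))) A" if "x \<in> X" for x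
    unfolding e_def
  proof (rule point_mass_residual)
    show "ell2_inner A \<beta> \<gamma> = (if \<beta> = \<gamma> then 1 else 0)" if "\<beta> \<in> F" "\<gamma> \<in> F" for \<beta> \<gamma>
      using that F(2) by (intro orth) auto
  qed (use that X(2) F B in auto)
  define k where "k \<beta> = (\<Sum>x\<in>X. \<phi> x * cnj (\<beta> x))" for \<beta>
  let ?d = "\<lambda>y. \<phi> y - (\<Sum>\<beta>\<in>F. k \<beta> * \<beta> y)"
  let ?t = "\<lambda>y. if y \<in> X then 0 else \<phi> y"
  have d: "?d y = ?t y + (\<Sum>x\<in>X. \<phi> x * e x y)" for y
  proof -
    have "(\<Sum>x\<in>X. \<phi> x * e x y)
        = (\<Sum>x\<in>X. if x = y then \<phi> x else 0) - (\<Sum>x\<in>X. \<Sum>\<beta>\<in>F. \<phi> x * cnj (\<beta> x) * \<beta> y)"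
      unfolding sum_subtractf[symmetric] e_def
      by (intro sum.cong refl) (simp add: sum_distrib_left right_diff_distrib mult.assoc)
    also have "(\<Sum>x\<in>X. \<Sum>\<beta>\<in>F. \<phi> x * cnj (\<beta> x) * \<beta> y) = (\<Sum>\<beta>\<in>F. k \<beta> * \<beta> y)"
      unfolding k_def sum_distrib_right by (rule sum.swap)
    also have "(\<Sum>x\<in>X. if x = y then \<phi> x else 0) = \<phi> y - ?t y"
      using X(1) by (simp add: sum.delta)
    finally show ?thesis by simp
  qed
  have bound: "(cmod (?d y))\<^sup>2 \<le> 2 * (if y \<in> X then 0 else (cmod (\<phi> y))\<^sup>2)
      + 2 * card X * (\<Sum>x\<in>X. (cmod (\<phi> x))\<^sup>2 * (cmod (e x y))\<^sup>2)" for y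
  proof -
    have sq: "(u + v)\<^sup>2 \<le> 2 * u\<^sup>2 + 2 * v\<^sup>2" for u v :: real
      using sum_squares_bound[of u v] by (simp add: power2_sum)
    have "cmod (?d y) \<le> cmod (?t y) + (\<Sum>x\<in>X. cmod (\<phi> x * e x y))"
      unfolding d by (intro order_trans[OF norm_triangle_ineq] add_left_mono norm_sum)
    then have "(cmod (?d y))\<^sup>2 \<le> (cmod (?t y) + (\<Sum>x\<in>X. cmod (\<phi> x * e x y)))\<^sup>2"
      by (intro power_mono) auto
    also have "\<dots> \<le> 2 * (cmod (?t y))\<^sup>2 + 2 * (\<Sum>x\<in>X. cmod (\<phi> x * e x y))\<^sup>2"
      by (rule sq)
    also have "\<dots> \<le> 2 * (cmod (?t y))\<^sup>2 + 2 * ((\<Sum>x\<in>X. (cmod (\<phi> x * e x y))\<^sup>2) * card X)"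
      by (intro add_left_mono mult_left_mono sum_squared_le_sum_of_squares) auto
    also have "\<dots> = 2 * (if y \<in> X then 0 else (cmod (\<phi> y))\<^sup>2)
        + 2 * card X * (\<Sum>x\<in>X. (cmod (\<phi> x))\<^sup>2 * (cmod (e x y))\<^sup>2)"
      by (cases "y \<in> X") (simp_all add: norm_mult power_mult_distrib)
    finally show ?thesis .
  qed
  have "((\<lambda>y. 2 * (if y \<in> X then 0 else (cmod (\<phi> y))\<^sup>2)
      + 2 * card X * (\<Sum>x\<in>X. (cmod (\<phi> x))\<^sup>2 * (cmod (e x y))\<^sup>2)) has_sum
      (2 * r + 2 * card X * (\<Sum>x\<in>X. (cmod (\<phi> x))\<^sup>2 * (1 - (\<Sum>\<beta>\<in>F. (cmod (\<beta> x))\<^sup>2))))) A"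
    by (rule has_sum_add[OF has_sum_cmult_right[OF X(4)] has_sum_cmult_right[OF has_sum_sum_finite]])
      (rule has_sum_cmult_right[OF e])
  then have "(ell2_norm A ?d)\<^sup>2
      \<le> 2 * r + 2 * card X * (\<Sum>x\<in>X. (cmod (\<phi> x))\<^sup>2 * (1 - (\<Sum>\<beta>\<in>F. (cmod (\<beta> x))\<^sup>2)))"
    by (rule ell2_norm_power2_le) (rule bound)
  also have "\<dots> \<le> 2 * r + 2 * card X * (\<Sum>x\<in>X. (cmod (\<phi> x))\<^sup>2 * \<eta>)"
    by (rule add_left_mono, rule mult_left_mono, rule sum_mono, rule mult_left_mono, rule F_eta) auto
  also have "\<dots> = 2 * r + 2 * (card X * C * \<eta>)"
    by (simp add: C_def sum_distrib_right)
  also have "\<dots> < \<epsilon>\<^sup>2"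
  proof -
    have "real (card X) * C * \<eta> \<le> M * \<eta>"
      using eta(1) by (intro mult_right_mono) (auto simp: M_def)
    then show ?thesis
      using X(3) eta(2) by linarith
  qed
  finally have "ell2_norm A ?d < \<epsilon>"
    using eps by (intro power_less_imp_less_base[of _ 2 \<epsilon>]) auto
  with F show "\<exists>F k. finite F \<and> F \<subseteq> B \<and> ell2_norm A (\<lambda>x. \<phi> x - (\<Sum>\<beta>\<in>F. k \<beta> * \<beta> x)) < \<epsilon>"
    by blast
qed (use B orth in auto)

section \<open>Sine vectors on a finite path\<close>

text \<open>
  For \<open>k \<in> {1..m}\<close> these are the normalised eigenvectors \<open>t \<mapsto> path_sine m k t\<close> of the adjacency matrix of
  the path with vertices \<open>1, \<dots>, m\<close>. Both arguments are real so that the matrix of eigenvectors is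
  visibly symmetric and the vectors can be evaluated at the boundary points \<open>0\<close> and \<open>m + 1\<close>, where
  they vanish.
\<close>

definition path_sine :: "nat \<Rightarrow> real \<Rightarrow> real \<Rightarrow> real" where
  "path_sine m x y = sqrt (2 / (real m + 1)) * sin (pi * x * y / (real m + 1))"

lemma path_sine_sym: "path_sine m x y = path_sine m y x"
  by (simp add: path_sine_def ac_simps)

lemma path_sine_step:
  "path_sine m x (y + 1) + path_sine m x (y - 1) = 2 * cos (pi * x / (real m + 1)) * path_sine m x y"
proof -
  define \<theta> where "\<theta> = pi * x / (real m + 1)"
  have "path_sine m x z = sqrt (2 / (real m + 1)) * sin (z * \<theta>)" for z
    by (simp add: path_sine_def \<theta>_def mult.commute)
  moreover have "sin ((y + 1) * \<theta>) + sin ((y - 1) * \<theta>) = 2 * cos \<theta> * sin (y * \<theta>)"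
    unfolding distrib_right left_diff_distrib mult_1 sin_add sin_diff by simp
  ultimately show ?thesis
    unfolding \<theta>_def[symmetric] by (simp only: distrib_left[symmetric] mult.left_commute)
qed

lemma path_sine_0: "path_sine m x 0 = 0"
  by (simp add: path_sine_def)

lemma path_sine_end: "path_sine m (real k) (real m + 1) = 0"
  using sin_npi[of k] by (simp add: path_sine_def ac_simps)

text \<open>
  Eigenvectors of a symmetric matrix for distinct eigenvalues are orthogonal; the symmetry
  appears as the telescoping of the discrete Wronskian \<open>?w\<close>, which vanishes at both boundary points.
\<close>

lemma path_sine_orthogonal:
  fixes k l :: nat
  assumes k: "k \<in> {1..m}" and l: "l \<in> {1..m}" and "k \<noteq> l"
  shows "(\<Sum>t\<in>{1..m}. path_sine m (real k) (real t) * path_sine m (real l) (real t)) = 0"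
proof -
  let ?S = "path_sine m"
  let ?c = "\<lambda>k. cos (pi * real k / (real m + 1))"
  let ?w = "\<lambda>t. ?S (real k) (real t + 1) * ?S (real l) (real t)
    - ?S (real k) (real t) * ?S (real l) (real t + 1)"
  have "2 * (?c k - ?c l) * (?S (real k) (real t) * ?S (real l) (real t)) = ?w t - ?w (t - 1)"
    if "t \<in> {1..m}" for t
  proof -
    have "real (t - 1) = real t - 1"
      using that by simp
    then have "?w t - ?w (t - 1)
        = (?S (real k) (real t + 1) + ?S (real k) (real t - 1)) * ?S (real l) (real t)
          - ?S (real k) (real t) * (?S (real l) (real t + 1) + ?S (real l) (real t - 1))"
      by (simp add: algebra_simps)
    then show ?thesis
      unfolding path_sine_step by (simp add: algebra_simps)
  qed
  then have "2 * (?c k - ?c l) * (\<Sum>t\<in>{1..m}. ?S (real k) (real t) * ?S (real l) (real t))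
      = (\<Sum>t\<in>{1..m}. ?w t - ?w (t - 1))"
    unfolding sum_distrib_left by (intro sum.cong) auto
  also have "\<dots> = ?w m - ?w 0"
    using sum_telescope''[of 0 m ?w] by simp
  also have "\<dots> = 0"
    by (simp add: path_sine_0 path_sine_end)
  finally have "?c k = ?c l \<or> ?thesis"
    by simp
  moreover have "?c k \<noteq> ?c l"
  proof
    assume "?c k = ?c l"
    then have "pi * real k / (real m + 1) = pi * real l / (real m + 1)"
    proof (rule cos_inj_pi[rotated 4])
      have "pi * real j / (real m + 1) \<le> pi" "0 \<le> pi * real j / (real m + 1)" if "j \<in> {1..m}" for j
        using that mult_left_mono[of "real j" "real m + 1" pi] by (auto simp: pos_divide_le_eq)
      then show "0 \<le> pi * real k / (real m + 1)" "pi * real k / (real m + 1) \<le> pi"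
          "0 \<le> pi * real l / (real m + 1)" "pi * real l / (real m + 1) \<le> pi"
        using k l by blast+
    qed
    with \<open>k \<noteq> l\<close> show False
      using pi_gt_zero by (simp add: frac_eq_eq)
  qed
  ultimately show ?thesis by blast
qed

text \<open>
  By the half-angle formula this comes down to \<open>\<Sum>\<^sub>t cos (2 t \<theta>) = -1\<close>, a sum that telescopes after
  multiplication by \<open>2 sin \<theta>\<close>.
\<close>

lemma path_sine_norm:
  fixes k :: nat
  assumes k: "k \<in> {1..m}"
  shows "(\<Sum>t\<in>{1..m}. (path_sine m (real k) (real t))\<^sup>2) = 1"
proof -
  define \<theta> where "\<theta> = pi * real k / (real m + 1)"
  have "0 < \<theta>" "\<theta> < pi"
    using k by (auto simp: \<theta>_def pos_divide_less_eq)
  then have sin: "sin \<theta> \<noteq> 0"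
    using sin_gt_zero by fastforce
  let ?w = "\<lambda>t. sin ((2 * real t + 1) * \<theta>)"
  have cos: "2 * sin \<theta> * cos (2 * real t * \<theta>) = ?w t - ?w (t - 1)" if "t \<in> {1..m}" for t
  proof -
    have "real (t - 1) = real t - 1"
      using that by simp
    then have "?w (t - 1) = sin (2 * real t * \<theta> - \<theta>)" "?w t = sin (2 * real t * \<theta> + \<theta>)"
      by (simp_all add: algebra_simps)
    then show ?thesis
      by (simp only: sin_add sin_diff) (simp add: algebra_simps)
  qed
  have "?w m = sin (real (2 * k) * pi - \<theta>)"
    by (simp add: \<theta>_def field_simps)
  also have "\<dots> = - sin \<theta>"
    using sin_npi[of "2 * k"] cos_npi[of "2 * k"] by (simp only: sin_diff) simp
  finally have wm: "?w m = - sin \<theta>" .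
  have "2 * sin \<theta> * (\<Sum>t\<in>{1..m}. cos (2 * real t * \<theta>)) = (\<Sum>t\<in>{1..m}. ?w t - ?w (t - 1))"
    unfolding sum_distrib_left using cos by (intro sum.cong) auto
  also have "\<dots> = ?w m - ?w 0"
    using sum_telescope''[of 0 m ?w] by simp
  also have "\<dots> = 2 * sin \<theta> * (- 1)"
    unfolding wm by simp
  finally have sum_cos: "(\<Sum>t\<in>{1..m}. cos (2 * real t * \<theta>)) = - 1"
    using sin by (simp only: mult_cancel_left) auto
  have "(path_sine m (real k) (real t))\<^sup>2 = (1 - cos (2 * real t * \<theta>)) / (real m + 1)" for t
  proof -
    have "(path_sine m (real k) (real t))\<^sup>2 = 2 / (real m + 1) * (sin (real t * \<theta>))\<^sup>2"
      by (simp add: path_sine_def power_mult_distrib \<theta>_def ac_simps)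
    moreover have "cos (2 * real t * \<theta>) = 1 - 2 * (sin (real t * \<theta>))\<^sup>2"
      using cos_double_sin[of "real t * \<theta>"] by (simp add: mult.assoc)
    ultimately show ?thesis by simp
  qed
  then have "(\<Sum>t\<in>{1..m}. (path_sine m (real k) (real t))\<^sup>2)
      = (real m - (\<Sum>t\<in>{1..m}. cos (2 * real t * \<theta>))) / (real m + 1)"
    by (simp add: sum_divide_distrib[symmetric] sum_subtractf)
  then show ?thesis
    unfolding sum_cos by (simp add: divide_simps)
qed

section \<open>Lamp configurations on a window\<close>

definition lamp_sign :: "laurent_F2 \<Rightarrow> int \<Rightarrow> real" where
  "lamp_sign P l = (if Poly_Mapping.lookup P l = 0 then 1 else - 1)"

definition agree_outside :: "int set \<Rightarrow> laurent_F2 \<Rightarrow> laurent_F2 set" where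
  "agree_outside I Q = {P. \<forall>k. k \<notin> I \<longrightarrow> Poly_Mapping.lookup P k = Poly_Mapping.lookup Q k}"

lemma laurent_minus: "P - R = (P + R :: laurent_F2)"
  using laurent_add_cancel[of P R] by (simp only: diff_eq_eq)

lemma lookup_flip:
  "Poly_Mapping.lookup (P + X_pow l) k
    = (if k = l then Poly_Mapping.lookup P k + 1 else Poly_Mapping.lookup P k)"
  by (simp add: lookup_add lookup_X_pow)

lemma lamp_sign_flip: "lamp_sign (P + X_pow l) k = (if k = l then - lamp_sign P k else lamp_sign P k)"
  by (cases "Poly_Mapping.lookup P k") (auto simp: lamp_sign_def lookup_flip)

lemma lamp_sign_square: "lamp_sign P k * lamp_sign P k = 1"
  by (simp add: lamp_sign_def)

lemma agree_outside_flip: "l \<in> I \<Longrightarrow> P + X_pow l \<in> agree_outside I Q \<longleftrightarrow> P \<in> agree_outside I Q"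
  by (auto simp: agree_outside_def lookup_flip)

lemma agree_outside_refl: "Q \<in> agree_outside I Q"
  by (simp add: agree_outside_def)

lemma agree_outside_cong: "Q' \<in> agree_outside I Q \<Longrightarrow> agree_outside I Q' = agree_outside I Q"
  by (auto simp: agree_outside_def)

lemma agree_outside_disjoint: "P \<in> agree_outside I Q \<Longrightarrow> P \<in> agree_outside I Q' \<Longrightarrow> Q' \<in> agree_outside I Q"
  by (auto simp: agree_outside_def)

lemma agree_outside_insert:
  assumes "l \<notin> I"
  shows "agree_outside (insert l I) Q = agree_outside I Q \<union> (\<lambda>P. P + X_pow l) ` agree_outside I Q"
proof (intro equalityI subsetI)
  fix P assume P: "P \<in> agree_outside (insert l I) Q"
  show "P \<in> agree_outside I Q \<union> (\<lambda>P. P + X_pow l) ` agree_outside I Q"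
  proof (cases "Poly_Mapping.lookup P l = Poly_Mapping.lookup Q l")
    case True
    then show ?thesis
      using P by (auto simp: agree_outside_def)
  next
    case False
    then have "Poly_Mapping.lookup P l + 1 = Poly_Mapping.lookup Q l"
      by (cases "Poly_Mapping.lookup P l"; cases "Poly_Mapping.lookup Q l") auto
    then have "P + X_pow l \<in> agree_outside I Q"
      using P by (auto simp: agree_outside_def lookup_flip)
    then have "P + X_pow l + X_pow l \<in> (\<lambda>P. P + X_pow l) ` agree_outside I Q"
      by (rule imageI)
    then show ?thesis
      by (simp only: laurent_add_cancel Un_iff) blast
  qed
next
  fix P assume "P \<in> agree_outside I Q \<union> (\<lambda>P. P + X_pow l) ` agree_outside I Q"
  then show "P \<in> agree_outside (insert l I) Q"
    by (auto simp: agree_outside_def lookup_flip)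
qed

text \<open>
  Each lamp of the window can be set freely. The count normalises the eigenfunctions.
\<close>

lemma card_agree_outside:
  assumes "finite I"
  shows "finite (agree_outside I Q) \<and> card (agree_outside I Q) = 2 ^ card I"
  using assms
proof (induction I)
  case empty
  have "agree_outside {} Q = {Q}"
    by (auto simp: agree_outside_def intro: poly_mapping_eqI)
  then show ?case by simp
next
  case (insert l I)
  have "inj_on (\<lambda>P. P + X_pow l) (agree_outside I Q)"
    by (rule inj_onI) simp
  moreover have "agree_outside I Q \<inter> (\<lambda>P. P + X_pow l) ` agree_outside I Q = {}"
    using insert(2) by (cases "Poly_Mapping.lookup Q l")
      (auto simp: agree_outside_def lookup_flip dest!: spec[of _ l])
  ultimately show ?case
    using insert unfolding agree_outside_insert[OF insert(2)]
    by (simp add: card_Un_disjoint card_image)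
qed

section \<open>Finitely supported modes\<close>

text \<open>
  Antisymmetric in the two end lamps \<open>i\<close> and \<open>i + m\<close>, symmetric in the lamps between them, and
  supported on the configurations that agree with \<open>Q\<close> outside the window. One function has several
  indices \<open>Q\<close>, among them every configuration in its support, which is convenient when it is
  evaluated at a given point.
\<close>

definition lamp_wave :: "int \<Rightarrow> nat \<Rightarrow> laurent_F2 \<Rightarrow> laurent_F2 \<Rightarrow> real" where
  "lamp_wave i m Q P = (if P \<in> agree_outside {i..i + int m} Q
     then lamp_sign P i * lamp_sign P (i + int m) / sqrt (2 ^ (m + 1)) else 0)"

text \<open>
  The lamplighter is confined to the \<open>m\<close> positions \<open>i, \<dots>, i + m - 1\<close>, since leaving them to the left
  involves the lamp \<open>i\<close> and to the right the lamp \<open>i + m\<close>. The shift by \<open>1\<close> numbers these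
  positions from \<open>1\<close> to \<open>m\<close>.
\<close>

definition mode :: "int \<Rightarrow> nat \<Rightarrow> nat \<Rightarrow> laurent_F2 \<Rightarrow> laurent_F2 \<times> int \<Rightarrow> real" where
  "mode i m k Q = (\<lambda>(P, n). if i \<le> n \<and> n < i + int m
     then lamp_wave i m Q P * path_sine m (real k) (of_int (n - i + 1)) else 0)"

lemma lamp_wave_flip:
  assumes "m > 0" "l \<in> {i..i + int m}"
  shows "lamp_wave i m Q (P + X_pow l)
    = (if l = i \<or> l = i + int m then - lamp_wave i m Q P else lamp_wave i m Q P)"
  using assms agree_outside_flip[OF assms(2)] by (auto simp: lamp_wave_def lamp_sign_flip)

lemma mode_flip:
  assumes "m > 0" "l \<in> {i..i + int m}"
  shows "mode i m k Q (P + X_pow l, n)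
    = (if l = i \<or> l = i + int m then - mode i m k Q (P, n) else mode i m k Q (P, n))"
  by (simp only: mode_def prod.case lamp_wave_flip[OF assms]) auto

lemma lamp_wave_square:
  "(lamp_wave i m Q P)\<^sup>2 = (if P \<in> agree_outside {i..i + int m} Q then 1 / 2 ^ (m + 1) else 0)"
  by (simp add: lamp_wave_def power_divide power2_eq_square[of "_ * _"] lamp_sign_square
      mult.commute[of "lamp_sign P i"] mult.assoc)

lemma lamp_wave_norm: "(\<Sum>P\<in>agree_outside {i..i + int m} Q. (lamp_wave i m Q P)\<^sup>2) = 1"
proof -
  have "card {i..i + int m} = m + 1"
    by simp
  then show ?thesis
    using card_agree_outside[of "{i..i + int m}" Q] by (simp add: lamp_wave_square)
qed

text \<open>
  The two values cancel when the lamplighter would enter the window from the left; inside the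
  window they agree, and at its right end the sine vanishes, so that one formula covers all
  positions of the window. The step to the left is the mirror image.
\<close>

lemma mode_step_right:
  assumes "m > 0"
  shows "mode i m k Q (P, n + 1) + mode i m k Q (P + X_pow (n + 1), n + 1)
    = (if i \<le> n \<and> n < i + int m
       then 2 * lamp_wave i m Q P * path_sine m (real k) (of_int (n - i + 1) + 1) else 0)"
proof -
  consider "n + 1 < i" | "n + 1 = i" | "i \<le> n" "n + 1 < i + int m" | "n + 1 = i + int m" | "i + int m \<le> n"
    using assms by linarith
  then show ?thesis
  proof cases
    case 2
    then show ?thesis
      using mode_flip[OF assms, of "n + 1" i k Q P "n + 1"] by auto
  next
    case 3
    then show ?thesis
      using mode_flip[OF assms, of "n + 1" i k Q P "n + 1"] by (auto simp: mode_def algebra_simps)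
  next
    case 4
    then have "of_int (n - i + 1) + 1 = real m + 1"
      by simp
    then show ?thesis
      using 4 by (simp only: mode_def prod.case path_sine_end) auto
  qed (auto simp: mode_def)
qed

lemma mode_step_left:
  assumes "m > 0"
  shows "mode i m k Q (P, n - 1) + mode i m k Q (P + X_pow n, n - 1)
    = (if i \<le> n \<and> n < i + int m
       then 2 * lamp_wave i m Q P * path_sine m (real k) (of_int (n - i + 1) - 1) else 0)"
proof -
  consider "n < i" | "n = i" | "i < n" "n < i + int m" | "n = i + int m" | "i + int m < n"
    by linarith
  then show ?thesis
  proof cases
    case 2
    then show ?thesis
      using path_sine_0[of m k] by (simp add: mode_def)
  next
    case 3
    then show ?thesis
      using mode_flip[OF assms, of n i k Q P "n - 1"] by (auto simp: mode_def algebra_simps)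
  next
    case 4
    then show ?thesis
      using mode_flip[OF assms, of n i k Q P "n - 1"] by auto
  qed (auto simp: mode_def)
qed

lemma mode_eigen:
  assumes "m > 0"
  shows "mode i m k Q (P, n + 1) + mode i m k Q (P + X_pow (n + 1), n + 1)
      + (mode i m k Q (P, n - 1) + mode i m k Q (P + X_pow n, n - 1))
    = 4 * cos (pi * real k / (real m + 1)) * mode i m k Q (P, n)"
proof (cases "i \<le> n \<and> n < i + int m")
  case True
  let ?S = "path_sine m (real k)" and ?t = "of_int (n - i + 1) :: real"
  have "2 * lamp_wave i m Q P * ?S (?t + 1) + 2 * lamp_wave i m Q P * ?S (?t - 1)
      = 2 * lamp_wave i m Q P * (?S (?t + 1) + ?S (?t - 1))"
    by (simp only: distrib_left)
  also have "\<dots> = 4 * cos (pi * real k / (real m + 1)) * (lamp_wave i m Q P * ?S ?t)"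
    unfolding path_sine_step by simp
  finally show ?thesis
    unfolding mode_step_right[OF assms] mode_step_left[OF assms] using True by (simp add: mode_def)
next
  case False
  then show ?thesis
    unfolding mode_step_right[OF assms] mode_step_left[OF assms] by (auto simp: mode_def)
qed

lemma finite_support_mode: "finite {g. mode i m k Q g \<noteq> 0}"
proof (rule finite_subset)
  show "{g. mode i m k Q g \<noteq> 0} \<subseteq> agree_outside {i..i + int m} Q \<times> {i..<i + int m}"
    by (auto simp: mode_def lamp_wave_def split: if_splits)
  show "finite (agree_outside {i..i + int m} Q \<times> {i..<i + int m})"
    using card_agree_outside[of "{i..i + int m}" Q] by simp
qed

section \<open>Orthogonality of the modes\<close>

lemma infsum_eq_0_if_odd:
  fixes f :: "'a \<Rightarrow> real"
  assumes "bij T" "\<And>x. f (T x) = - f x"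
  shows "infsum f UNIV = 0"
  using infsum_reindex_bij_betw[OF assms(1), of f] assms(2) by (simp add: infsum_uminus)

lemma infsum_eq_0_if_flip_odd:
  fixes f :: "laurent_F2 \<times> int \<Rightarrow> real"
  assumes "\<And>P n. f (P + X_pow l, n) = - f (P, n)"
  shows "infsum f UNIV = 0"
proof (rule infsum_eq_0_if_odd)
  show "bij (\<lambda>(P, n). (P + X_pow l, n) :: laurent_F2 \<times> int)"
    by (rule bij_betw_byWitness[where f' = "\<lambda>(P, n). (P + X_pow l, n)"])
      (auto simp: laurent_add_cancel)
qed (auto simp: assms)

text \<open>
  Where both functions are nonzero, the left end lamp \<open>i'\<close> of the second window lies strictly
  inside the first window, so switching it changes the sign of the product.
\<close>

lemma mode_orthogonal_left_end:
  assumes "m > 0" "m' > 0" "i < i'"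
  shows "(\<Sum>\<^sub>\<infinity>g. mode i m k Q g * mode i' m' k' Q' g) = 0"
proof (cases "i' < i + int m")
  case True
  show ?thesis
    by (rule infsum_eq_0_if_flip_odd[of _ i'])
      (use assms True in \<open>simp add: mode_flip\<close>)
next
  case False
  then have "mode i m k Q g * mode i' m' k' Q' g = 0" for g
    by (cases g) (auto simp: mode_def)
  then show ?thesis
    by (rule infsum_0)
qed

text \<open>
  The right end lamp of the shorter window lies strictly inside the longer one.
\<close>

lemma mode_orthogonal_right_end:
  assumes "m > 0" "m < m'"
  shows "(\<Sum>\<^sub>\<infinity>g. mode i m k Q g * mode i m' k' Q' g) = 0"
  by (rule infsum_eq_0_if_flip_odd[of _ "i + int m"]) (use assms in \<open>simp add: mode_flip\<close>)

lemma mode_inner_same_window: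
  assumes k: "k \<in> {1..m}" and k': "k' \<in> {1..m}"
  shows "(\<Sum>\<^sub>\<infinity>g. mode i m k Q g * mode i m k' Q g) = (if k = k' then 1 else 0)"
proof -
  let ?A = "agree_outside {i..i + int m} Q" and ?N = "{i..<i + int m}"
  let ?S = "\<lambda>k n. path_sine m (real k) (of_int (n - i + 1))"
  have fin: "finite (?A \<times> ?N)"
    using card_agree_outside[of "{i..i + int m}" Q] by simp
  have "(\<Sum>\<^sub>\<infinity>g. mode i m k Q g * mode i m k' Q g)
      = (\<Sum>\<^sub>\<infinity>g\<in>?A \<times> ?N. mode i m k Q g * mode i m k' Q g)"
    by (rule infsum_cong_neutral) (auto simp: mode_def lamp_wave_def split: if_splits)
  also have "\<dots> = (\<Sum>g\<in>?A \<times> ?N. mode i m k Q g * mode i m k' Q g)"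
    using fin by (rule infsum_finite)
  also have "\<dots> = (\<Sum>g\<in>?A \<times> ?N. (lamp_wave i m Q (fst g))\<^sup>2 * (?S k (snd g) * ?S k' (snd g)))"
    by (rule sum.cong) (auto simp: mode_def power2_eq_square)
  also have "\<dots> = (\<Sum>P\<in>?A. (lamp_wave i m Q P)\<^sup>2) * (\<Sum>n\<in>?N. ?S k n * ?S k' n)"
    by (simp add: sum_product sum.cartesian_product case_prod_unfold)
  also have "(\<Sum>n\<in>?N. ?S k n * ?S k' n)
      = (\<Sum>t\<in>{1..m}. path_sine m (real k) (real t) * path_sine m (real k') (real t))"
    by (rule sum.reindex_bij_witness[of _ "\<lambda>t. i + int t - 1" "\<lambda>n. nat (n - i + 1)"]) auto
  also have "\<dots> = (if k = k' then 1 else 0)"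
    using path_sine_orthogonal[OF k k'] path_sine_norm[OF k]
    by (cases "k = k'") (simp_all add: power2_eq_square)
  finally show ?thesis
    by (simp add: lamp_wave_norm)
qed

lemma mode_cong:
  assumes "Q' \<in> agree_outside {i..i + int m} Q"
  shows "mode i m k Q' = mode i m k Q"
proof -
  have eq: "lamp_wave i m Q' = lamp_wave i m Q"
    using agree_outside_cong[OF assms] by (simp add: fun_eq_iff lamp_wave_def)
  show ?thesis
    unfolding mode_def eq ..
qed

lemma mode_inner:
  assumes k: "k \<in> {1..m}" and k': "k' \<in> {1..m'}"
  shows "(\<Sum>\<^sub>\<infinity>g. mode i m k Q g * mode i' m' k' Q' g)
    = (if i = i' \<and> m = m' \<and> k = k' \<and> Q' \<in> agree_outside {i..i + int m} Q then 1 else 0)"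
proof -
  have m: "m > 0" "m' > 0"
    using k k' by auto
  consider "i < i'" | "i' < i" | "i = i'" "m < m'" | "i = i'" "m' < m"
    | "i = i'" "m = m'" "Q' \<in> agree_outside {i..i + int m} Q"
    | "i = i'" "m = m'" "Q' \<notin> agree_outside {i..i + int m} Q"
    by fastforce
  then show ?thesis
  proof cases
    case 1
    then show ?thesis
      using mode_orthogonal_left_end[OF m] by simp
  next
    case 2
    then show ?thesis
      using mode_orthogonal_left_end[OF m(2,1) 2, of k' Q' k Q] by (simp add: mult.commute)
  next
    case 3
    then show ?thesis
      using mode_orthogonal_right_end[OF m(1)] by simp
  next
    case 4
    then show ?thesis
      using mode_orthogonal_right_end[OF m(2) 4(2), of i k' Q' k Q] by (simp add: mult.commute)
  next
    case 5
    then show ?thesis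
      using mode_inner_same_window[OF k] k' mode_cong[OF 5(3)] by simp
  next
    case 6
    then have "mode i m k Q g * mode i' m' k' Q' g = 0" for g
      using agree_outside_disjoint[of _ "{i..i + int m}" Q Q']
      by (cases g) (auto simp: mode_def lamp_wave_def)
    then have "(\<Sum>\<^sub>\<infinity>g. mode i m k Q g * mode i' m' k' Q' g) = 0"
      by (rule infsum_0)
    then show ?thesis
      using 6(3) by simp
  qed
qed

section \<open>The Hilbert basis\<close>

definition mode_basis :: "(laurent_F2 \<times> int \<Rightarrow> complex) set" where
  "mode_basis = {\<lambda>g. of_real (mode i m k Q g) | i m k Q. k \<in> {1..m}}"

lemma ell2_inner_mode:
  assumes "k \<in> {1..m}" "k' \<in> {1..m'}"
  shows "ell2_inner UNIV (\<lambda>g. of_real (mode i m k Q g)) (\<lambda>g. of_real (mode i' m' k' Q' g))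
    = (if i = i' \<and> m = m' \<and> k = k' \<and> Q' \<in> agree_outside {i..i + int m} Q then 1 else 0)"
proof -
  have "finite {g. mode i m k Q g * mode i' m' k' Q' g \<noteq> 0}"
    by (rule finite_subset[OF _ finite_support_mode[of i m k Q]]) auto
  then have "(\<lambda>g. mode i m k Q g * mode i' m' k' Q' g) summable_on UNIV"
    by (intro finite_nonzero_values_imp_summable_on) auto
  then have "((\<lambda>g. mode i m k Q g * mode i' m' k' Q' g) has_sum
      (\<Sum>\<^sub>\<infinity>g. mode i m k Q g * mode i' m' k' Q' g)) UNIV"
    by (rule has_sum_infsum)
  from has_sum_of_real[OF this, where 'a = complex]
  have "ell2_inner UNIV (\<lambda>g. of_real (mode i m k Q g)) (\<lambda>g. of_real (mode i' m' k' Q' g))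
      = of_real (\<Sum>\<^sub>\<infinity>g. mode i m k Q g * mode i' m' k' Q' g)"
    unfolding ell2_inner_def by (intro infsumI) simp
  then show ?thesis
    unfolding mode_inner[OF assms] by auto
qed

lemma mode_basis_eigenfunction:
  assumes "\<phi> \<in> mode_basis"
  shows "laplace_eigenfunction lamplighter {(0, 1), (X_pow 1, 1)} \<phi>" "finite {g. \<phi> g \<noteq> 0}"
proof -
  obtain i m k Q where k: "k \<in> {1..m}" and phi: "\<phi> = (\<lambda>g. of_real (mode i m k Q g))"
    using assms unfolding mode_basis_def by blast
  have m: "m > 0"
    using k by auto
  show fin: "finite {g. \<phi> g \<noteq> 0}"
    unfolding phi using finite_support_mode by simp
  have "\<phi> \<in> ell2 UNIV"
    unfolding ell2_def using fin by (auto intro!: finite_nonzero_values_imp_summable_on)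
  moreover have "\<exists>g. \<phi> g \<noteq> 0"
  proof (rule ccontr)
    assume "\<nexists>g. \<phi> g \<noteq> 0"
    then have "\<phi> = (\<lambda>_. 0)"
      by auto
    then have "ell2_inner UNIV \<phi> \<phi> = 0"
      by (simp add: ell2_inner_def)
    then show False
      unfolding phi ell2_inner_mode[OF k k] by (simp add: agree_outside_refl)
  qed
  moreover have "cayley_laplacian lamplighter {(0, 1), (X_pow 1, 1)} \<phi> (P, n)
      = of_real (1 - cos (pi * real k / (real m + 1))) * \<phi> (P, n)" for P n
  proof -
    have ne: "(0, 1) \<noteq> (X_pow 1, 1 :: int)"
      using lookup_X_pow[of 1 1] by (metis Pair_inject lookup_zero zero_neq_one)
    have inv: "inv\<^bsub>lamplighter\<^esub> (X_pow 1, 1) = (1, - 1)"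
      using laurent_double[of 1] by (simp add: inv_lamplighter X_pow_0 neg_eq_iff_add_eq_0 flip: X_pow_add)
    have "cayley_laplacian lamplighter {(0, 1), (X_pow 1, 1)} \<phi> (P, n) = \<phi> (P, n)
        - 1 / 4 * of_real (mode i m k Q (P, n + 1) + mode i m k Q (P + X_pow (n + 1), n + 1)
          + (mode i m k Q (P, n - 1) + mode i m k Q (P + X_pow n, n - 1)))"
      using ne by (simp add: cayley_laplacian_def inv inv_lamplighter phi laurent_minus flip: X_pow_add)
    then show ?thesis
      unfolding mode_eigen[OF m] by (simp add: phi algebra_simps)
  qed
  ultimately show "laplace_eigenfunction lamplighter {(0, 1), (X_pow 1, 1)} \<phi>"
    unfolding laplace_eigenfunction_def
    by (auto intro!: exI[of _ "1 - cos (pi * real k / (real m + 1))"])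
qed

text \<open>
  The contribution to Parseval's identity at \<open>(P, n)\<close> of the window that extends \<open>p\<close> positions to the
  left and \<open>q\<close> positions to the right of the lamplighter. The symmetry of the sine matrix turns the sum over frequencies
  into the norm of a sine vector.
\<close>

lemma mode_square_sum:
  "(\<Sum>k\<in>{1..p + q + 1}. (mode (n - int p) (p + q + 1) k P (P, n))\<^sup>2)
    = (1 / 2) ^ (p + 1) * (1 / 2) ^ (q + 1)"
proof -
  have "mode (n - int p) (p + q + 1) k P (P, n)
      = lamp_wave (n - int p) (p + q + 1) P P * path_sine (p + q + 1) (real (p + 1)) (real k)" for k
    by (subst path_sine_sym) (simp add: mode_def ac_simps)
  then have "(\<Sum>k\<in>{1..p + q + 1}. (mode (n - int p) (p + q + 1) k P (P, n))\<^sup>2)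
      = (lamp_wave (n - int p) (p + q + 1) P P)\<^sup>2
        * (\<Sum>k\<in>{1..p + q + 1}. (path_sine (p + q + 1) (real (p + 1)) (real k))\<^sup>2)"
    by (simp only: power_mult_distrib sum_distrib_left)
  also have "\<dots> = 1 / 2 ^ (p + q + 1 + 1)"
    by (subst path_sine_norm) (auto simp: lamp_wave_square agree_outside_refl)
  finally show ?thesis
    by (simp add: power_add power_divide)
qed

text \<open>
  With windows that extend less than \<open>r\<close> positions in each direction the squares add up to
  \<open>(1 - 2\<^bsup>-r\<^esup>)\<^sup>2\<close>.
\<close>

lemma mode_basis_parseval:
  assumes "\<eta> > 0"
  shows "\<exists>F. finite F \<and> F \<subseteq> mode_basis \<and> 1 - \<eta> < (\<Sum>\<beta>\<in>F. (cmod (\<beta> g))\<^sup>2)"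
proof -
  obtain P n where g: "g = (P, n)"
    by (cases g)
  have "(\<lambda>r. (1 - (1 / 2 :: real) ^ r)\<^sup>2) \<longlonglongrightarrow> (1 - 0)\<^sup>2"
    by (intro tendsto_intros LIMSEQ_power_zero) auto
  then have "\<forall>\<^sub>F r in sequentially. 1 - \<eta> < (1 - (1 / 2) ^ r)\<^sup>2"
    using assms by (intro order_tendstoD(1)) auto
  then obtain r where r: "1 - \<eta> < (1 - (1 / 2 :: real) ^ r)\<^sup>2"
    using eventually_happens by fastforce
  define I where "I = Sigma ({..<r} \<times> {..<r}) (\<lambda>pq. {1..fst pq + snd pq + 1})"
  define \<beta> where "\<beta> = (\<lambda>(pq, k) g. complex_of_real (mode (n - int (fst pq)) (fst pq + snd pq + 1) k P g))"
  have "inj_on \<beta> I"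
  proof (rule inj_onI)
    fix x y assume x: "x \<in> I" and y: "y \<in> I" and eq: "\<beta> x = \<beta> y"
    obtain p q k p' q' k' where xy: "x = ((p, q), k)" "y = ((p', q'), k')"
      by (metis surj_pair)
    have k: "k \<in> {1..p + q + 1}" "k' \<in> {1..p' + q' + 1}"
      using x y by (auto simp: I_def xy)
    have "ell2_inner UNIV (\<beta> x) (\<beta> y) = ell2_inner UNIV (\<beta> x) (\<beta> x)"
      by (simp add: eq)
    then show "x = y"
      using k by (simp add: \<beta>_def xy ell2_inner_mode agree_outside_refl split: if_splits)
  qed
  then have "(\<Sum>\<beta>\<in>\<beta> ` I. (cmod (\<beta> g))\<^sup>2) = (\<Sum>x\<in>I. (cmod (\<beta> x g))\<^sup>2)"
    by (simp add: sum.reindex)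
  also have "\<dots> = (\<Sum>pq\<in>{..<r} \<times> {..<r}. \<Sum>k\<in>{1..fst pq + snd pq + 1}. (cmod (\<beta> (pq, k) g))\<^sup>2)"
    unfolding I_def by (subst sum.Sigma) auto
  also have "\<dots> = (\<Sum>pq\<in>{..<r} \<times> {..<r}. (1 / 2) ^ (fst pq + 1) * (1 / 2) ^ (snd pq + 1))"
    unfolding mode_square_sum[where n = n and P = P, symmetric] by (simp add: \<beta>_def g)
  also have "\<dots> = (\<Sum>p<r. (1 / 2) ^ (p + 1)) * (\<Sum>q<r. (1 / 2) ^ (q + 1))"
    by (simp only: sum_product sum.cartesian_product case_prod_unfold)
  also have "(\<Sum>p<r. (1 / 2) ^ (p + 1)) = 1 - (1 / 2 :: real) ^ r"
    by (induction r) (auto simp: field_simps)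
  finally have "1 - \<eta> < (\<Sum>\<beta>\<in>\<beta> ` I. (cmod (\<beta> g))\<^sup>2)"
    using r by (simp add: power2_eq_square)
  moreover have "finite (\<beta> ` I)"
    by (auto simp: I_def)
  moreover have "\<beta> ` I \<subseteq> mode_basis"
  proof (intro image_subsetI)
    fix x assume "x \<in> I"
    then obtain pq k where "x = (pq, k)" "k \<in> {1..fst pq + snd pq + 1}"
      unfolding I_def by blast
    then show "\<beta> x \<in> mode_basis"
      unfolding mode_basis_def \<beta>_def by (simp only: prod.case) blast
  qed
  ultimately show ?thesis by blast
qed

lemma hilbert_basis_mode_basis: "hilbert_basis (carrier lamplighter) mode_basis"
  unfolding carrier_lamplighter
proof (rule hilbert_basisI_point_masses)
  show "mode_basis \<subseteq> ell2 UNIV"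
    using mode_basis_eigenfunction(1) by (auto simp: laplace_eigenfunction_def)
  show "ell2_inner UNIV \<phi> \<psi> = (if \<phi> = \<psi> then 1 else 0)"
    if mem: "\<phi> \<in> mode_basis" "\<psi> \<in> mode_basis" for \<phi> \<psi>
  proof -
    obtain i m k Q where k: "k \<in> {1..m}" and phi: "\<phi> = (\<lambda>g. of_real (mode i m k Q g))"
      using mem(1) unfolding mode_basis_def by blast
    obtain i' m' k' Q' where k': "k' \<in> {1..m'}" and psi: "\<psi> = (\<lambda>g. of_real (mode i' m' k' Q' g))"
      using mem(2) unfolding mode_basis_def by blast
    have "ell2_inner UNIV \<phi> \<phi> = 1"
      unfolding phi ell2_inner_mode[OF k k] by (simp add: agree_outside_refl)
    moreover have "ell2_inner UNIV \<phi> \<psi> = 0 \<or> \<phi> = \<psi>"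
      unfolding phi psi ell2_inner_mode[OF k k'] using mode_cong by auto
    ultimately show ?thesis by auto
  qed
qed (rule mode_basis_parseval)

theorem corollary1p3:
  fixes a b c :: "laurent_F2 \<times> int"
  assumes "a = (0, 1)"
    and "c = (1, 0)"
    and "b = a \<otimes>\<^bsub>lamplighter\<^esub> c"
  shows "(\<nexists>\<phi>. laplace_eigenfunction lamplighter {a, c} \<phi>) \<and>
    (\<exists>B. hilbert_basis (carrier lamplighter) B \<and>
      (\<forall>\<phi>\<in>B. laplace_eigenfunction lamplighter {a, b} \<phi> \<and>
        finite {g \<in> carrier lamplighter. \<phi> g \<noteq> 0}))"
proof (intro conjI exI ballI)
  show "\<nexists>\<phi>. laplace_eigenfunction lamplighter {a, c} \<phi>"
    unfolding assms(1,2) using no_switch_walk_eigenfunction by blast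
  show "hilbert_basis (carrier lamplighter) mode_basis"
    by (rule hilbert_basis_mode_basis)
  fix \<phi> assume phi: "\<phi> \<in> mode_basis"
  have "b = (X_pow 1, 1)"
    unfolding assms by simp
  then show "laplace_eigenfunction lamplighter {a, b} \<phi>"
    unfolding assms(1) using mode_basis_eigenfunction(1)[OF phi] by simp
  show "finite {g \<in> carrier lamplighter. \<phi> g \<noteq> 0}"
    using mode_basis_eigenfunction(2)[OF phi] by simp
qed

end
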